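(* Let $K=\prod_{i=1}^d[a_i,b_i]\subseteq\mathbb{R}^d$ with $a_i<b_i$ for every $i$. Let $\mathcal{X}\subseteq\mathbb{R}^d$ be an open set with $K\subseteq\mathcal{X}$, let $f:\mathcal{X}\to\mathbb{R}$ be continuously differentiable, and let $g:\mathcal{X}\to\mathbb{R}$ be locally Lipschitz, bounded from below, and regular in the sense of Clarke. Let $(\gamma_k)_{k\ge1}$ be positive real numbers with $\sum_{k=1}^\infty\gamma_k=\infty$ and $\lim_{k\to\infty}\gamma_k=0$. Let $x_0\in K$, let $(H_k)_{k\ge1}$ be $\mathbb{R}^d$-valued random variables, and let $(x_k)_{k\ge1}$ be a random sequence generated by one of the iterations $$\text{(A)}\quad x_k\in\operatorname{prox}_{\gamma_k(g+\mathbb{I}_K)}\big(x_{k-1}-\gamma_kH_k\big),\quad k\ge1,$$ $$\text{(B)}\quad x_k\in\Pi_K\Big(\operatorname{prox}_{\gamma_kg}\big(x_{k-1}-\gamma_kH_k\big)\Big),\quad k\ge1.$$ Put $\delta_k=H_k-\nabla f(x_{k-1})$ and assume that $\delta_k=e_k+r_k$, where $(e_k)_k$, $(r_k)_k$ are sequences of $\mathbb{R}^d$-valued random variables such that almost surely $\lim_{k\to\infty}|r_k|=0$ and the series $\sum_{k=1}^\infty\gamma_ke_k$ converges. Let $$\mathcal{S}=\{x\in K:\ 0\in\nabla f(x)+\bar\partial g(x)+N_K(x)\},$$ and suppose that $(f+g)(\mathcal{S})\subseteq\mathbb{R}$ has empty interior. Then: (i) If $(x_k)$ is generated by (A), then $(x_k)$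 converges to $\mathcal{S}$ almost surely, i.e. $\operatorname{dist}(x_k,\mathcal{S})\to0$ almost surely. (ii) If, in addition, $g$ is Lipschitz on $\mathcal{X}$ and $(x_k)$ is generated by (B), then $(x_k)$ converges to $\mathcal{S}$ almost surely, i.e. $\operatorname{dist}(x_k,\mathcal{S})\to0$ almost surely.
   Context: $\mathbb{I}_K$ is the convex indicator function of $K$: $\mathbb{I}_K(x)=0$ if $x\in K$ and $+\infty$ otherwise. For $\gamma>0$ and $\phi:\mathcal{X}\to\mathbb{R}\cup\{+\infty\}$, $\operatorname{prox}_{\gamma\phi}(x)=\arg\min_{y\in\mathcal{X}}\{\phi(y)+\frac1{2\gamma}\|x-y\|^2\}$ is the (possibly multi-element) set of minimizers; the iterations are understood as inclusions that the sequence $(x_k)$ satisfies. $\Pi_K$ is the Euclidean projection onto $K$, applied elementwise to a set in (B). $N_K(x)=\{b\in\mathbb{R}^d:\langle b,x-c\rangle\ge0\ \text{for all }c\in K\}$ is the outer normal cone to $K$ at $x\in K$. For locally Lipschitz $g$, the Clarke generalized directional derivative is $g^\circ(x;v)=\limsup_{y\to x,\,t\downarrow0}\frac{g(y+tv)-g(y)}{t}$ and the Clarke gradient is $\bar\partial g(x)=\{\xi\in\mathbb{R}^d:\langle\xi,v\rangle\le g^\circ(x;v)\ \text{for all }v\in\mathbb{R}^d\}$. $g$ is regular in the sense of Clarke if for all $x\in\mathcal{X}$ and $v\in\mathbb{R}^d$ the one-sided directional derivative $g'(x;v)=\lim_{t\downarrow0}\frac{g(x+tv)-g(x)}{t}$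 exists and equals $g^\circ(x;v)$. *)

theory Defs
  imports "HOL-Probability.Probability" "HOL-Library.Set_Algebras"
begin

text \<open>Functions on an open set \<open>X\<close> are represented by total functions together with \<open>X\<close>; no
  notion below depends on the values taken outside \<open>X\<close> when it is used at points of \<open>X\<close>.\<close>

definition locally_lipschitz_on :: "'a::metric_space set \<Rightarrow> ('a \<Rightarrow> real) \<Rightarrow> bool" where
  "locally_lipschitz_on X g \<longleftrightarrow> (\<forall>x\<in>X. \<exists>u>0. \<exists>L. L-lipschitz_on (cball x u \<inter> X) g)"

definition convex_indicator :: "'a set \<Rightarrow> 'a \<Rightarrow> ereal" where
  "convex_indicator K x = (if x \<in> K then 0 else \<infinity>)"

definition prox :: "'a::real_normed_vector set \<Rightarrow> real \<Rightarrow> ('a \<Rightarrow> ereal) \<Rightarrow> 'a \<Rightarrow> 'a set" where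
  "prox X \<gamma> \<phi> x =
     {y \<in> X. \<forall>z\<in>X. \<phi> y + ereal (1 / (2 * \<gamma>) * (norm (x - y))\<^sup>2)
                  \<le> \<phi> z + ereal (1 / (2 * \<gamma>) * (norm (x - z))\<^sup>2)}"

definition normal_cone :: "'a::real_inner set \<Rightarrow> 'a \<Rightarrow> 'a set" where
  "normal_cone K x = {b. \<forall>c\<in>K. b \<bullet> (x - c) \<ge> 0}"

text \<open>The base point \<open>y\<close> ranges over full neighbourhoods of \<open>x\<close>, including \<open>y = x\<close>. The upper
  limit is taken in the extended reals; it is finite for locally Lipschitz \<open>g\<close>.\<close>

definition clarke_dirderiv ::
  "('a::real_normed_vector \<Rightarrow> real) \<Rightarrow> 'a \<Rightarrow> 'a \<Rightarrow> ereal" where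
  "clarke_dirderiv g x v =
     Limsup (nhds x \<times>\<^sub>F at_right 0) (\<lambda>(y, t). ereal ((g (y + t *\<^sub>R v) - g y) / t))"

definition clarke_gradient :: "('a::real_inner \<Rightarrow> real) \<Rightarrow> 'a \<Rightarrow> 'a set" where
  "clarke_gradient g x = {\<xi>. \<forall>v. ereal (\<xi> \<bullet> v) \<le> clarke_dirderiv g x v}"

definition clarke_regular_on :: "'a::real_normed_vector set \<Rightarrow> ('a \<Rightarrow> real) \<Rightarrow> bool" where
  "clarke_regular_on X g \<longleftrightarrow>
     (\<forall>x\<in>X. \<forall>v. \<exists>D. ((\<lambda>t. (g (x + t *\<^sub>R v) - g x) / t) \<longlongrightarrow> D) (at_right 0)
                  \<and> ereal D = clarke_dirderiv g x v)"

definition stationary_set ::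
  "'a::real_inner set \<Rightarrow> ('a \<Rightarrow> 'a) \<Rightarrow> ('a \<Rightarrow> real) \<Rightarrow> 'a set" where
  "stationary_set K gradf g =
     {x \<in> K. 0 \<in> {gradf x} + clarke_gradient g x + normal_cone K x}"

text \<open>\<open>infdist x {} = 0\<close> by library convention, whereas the distance to the empty set is
  \<open>+\<infinity>\<close> in the usual reading, hence the nonemptiness conjunct.\<close>

definition converges_to_set :: "(nat \<Rightarrow> 'a::metric_space) \<Rightarrow> 'a set \<Rightarrow> bool" where
  "converges_to_set u S \<longleftrightarrow> S \<noteq> {} \<and> (\<lambda>k. infdist (u k) S) \<longlonglongrightarrow> 0"

text \<open>Sample paths of the two iterations; \<open>K\<close> is nonempty, closed and convex in the application,
  so that \<open>closest_point K\<close> is the Euclidean projection.\<close>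

definition prox_iteration_A ::
  "'a::euclidean_space set \<Rightarrow> 'a set \<Rightarrow> ('a \<Rightarrow> real) \<Rightarrow> (nat \<Rightarrow> real) \<Rightarrow> (nat \<Rightarrow> 'a) \<Rightarrow> (nat \<Rightarrow> 'a) \<Rightarrow> bool"
  where
  "prox_iteration_A X K g \<gamma> h x \<longleftrightarrow>
     (\<forall>k\<ge>1. x k \<in> prox X (\<gamma> k) (\<lambda>y. ereal (g y) + convex_indicator K y)
                       (x (k - 1) - \<gamma> k *\<^sub>R h k))"

definition prox_iteration_B ::
  "'a::euclidean_space set \<Rightarrow> 'a set \<Rightarrow> ('a \<Rightarrow> real) \<Rightarrow> (nat \<Rightarrow> real) \<Rightarrow> (nat \<Rightarrow> 'a) \<Rightarrow> (nat \<Rightarrow> 'a) \<Rightarrow> bool"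
  where
  "prox_iteration_B X K g \<gamma> h x \<longleftrightarrow>
     (\<forall>k\<ge>1. x k \<in> closest_point K `
                  prox X (\<gamma> k) (\<lambda>y. ereal (g y)) (x (k - 1) - \<gamma> k *\<^sub>R h k))"

end

theory Submission
  imports Defs "HOL-Complex_Analysis.Great_Picard"
begin

text \<open>Both iterations have the form
  \<open>x\<^sub>k = x\<^sub>k\<^sub>-\<^sub>1 - \<gamma>\<^sub>k (\<nabla>f(x\<^sub>k\<^sub>-\<^sub>1) + v\<^sub>k + r\<^sub>k + e\<^sub>k) - n\<^sub>k\<close> with \<open>v\<^sub>k\<close> a Clarke gradient of \<open>g\<close> at a
  point close to \<open>x\<^sub>k\<close> and \<open>n\<^sub>k\<close> normal to the box at \<open>x\<^sub>k\<close>. The partial sums of \<open>\<gamma>\<^sub>k e\<^sub>k\<close> converge, so a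
  coordinatewise reflection argument makes the path, read in the time scale \<open>\<Sum>\<gamma>\<^sub>k\<close>, asymptotically
  Lipschitz, and pieces of it starting near a limit point have a Lipschitz limit curve \<open>z\<close>. At every
  time \<open>s\<close> and for all small \<open>h > 0\<close>, \<open>z(s - h) - z(s)\<close> is, up to \<open>o(h)\<close>, \<open>h\<close> times an element of
  \<open>\<nabla>f + \<partial>g + N\<close> at \<open>z(s)\<close>; since regularity makes Clarke gradients Frechet subgradients,
  \<open>F = f + g\<close> increases backwards along \<open>z\<close> at a rate at least half the squared distance of this set
  to \<open>0\<close>. Hence \<open>F\<close> drops by a fixed amount each time the path passes near a nonstationary point. If
  some limit point were not stationary, \<open>F\<close> would cross some interval infinitely often; choosing a
  level of that interval outside \<open>F(S)\<close>, the last point below the level before a crossing is nearly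
  nonstationary at that level, from where \<open>F\<close> must drop instead of completing the crossing.\<close>

subsection \<open>Clarke gradients\<close>

text \<open>An epsilon-delta form of "the Clarke derivative of \<open>g\<close> at \<open>x\<close>
  along \<open>v\<close> is at most \<open>c\<close>", free of extended reals and product filters.
  It holds for every \<open>c\<close> above the derivative and implies that the derivative is at
  most \<open>c\<close>; at equality it may fail.\<close>

definition dir_bound :: "('a::real_normed_vector \<Rightarrow> real) \<Rightarrow> 'a \<Rightarrow> 'a \<Rightarrow> real \<Rightarrow> bool" where
  "dir_bound g x v c \<longleftrightarrow>
     (\<exists>d>0. \<forall>y t. dist y x < d \<longrightarrow> 0 < t \<longrightarrow> t < d \<longrightarrow> g (y + t *\<^sub>R v) - g y \<le> c * t)"

lemma dir_boundI:
  assumes "d > 0" "\<And>y t. dist y x < d \<Longrightarrow> 0 < t \<Longrightarrow> t < d \<Longrightarrow> g (y + t *\<^sub>R v) - g y \<le> c * t"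
  shows "dir_bound g x v c"
  using assms unfolding dir_bound_def by blast

text \<open>Base points already range over a ball around \<open>x\<close>, so half the radius serves
  every nearby \<open>z\<close>. This is upper semicontinuity of the Clarke derivative in the base
  point.\<close>

lemma dir_bound_nearby:
  assumes "dir_bound g x v c"
  obtains d where "d > 0" "\<And>z. dist z x < d \<Longrightarrow> dir_bound g z v c"
proof -
  obtain d where d: "d > 0"
    "\<And>y t. dist y x < d \<Longrightarrow> 0 < t \<Longrightarrow> t < d \<Longrightarrow> g (y + t *\<^sub>R v) - g y \<le> c * t"
    using assms unfolding dir_bound_def by blast
  have "dir_bound g z v c" if "dist z x < d / 2" for z
  proof (rule dir_boundI[of "d / 2"])
    fix y t assume yt: "dist y z < d / 2" "0 < t" "t < d / 2"
    have "dist y x < d" using dist_triangle[of y x z] yt that by linarith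
    then show "g (y + t *\<^sub>R v) - g y \<le> c * t" using d yt by simp
  qed (use d in simp)
  then show ?thesis using that[of "d / 2"] d by simp
qed

lemma small_step_in_ball:
  fixes v x :: "'a::real_normed_vector"
  assumes "d > 0"
  obtains q where "q > 0" "q \<le> d"
    "\<And>y t. dist y x < q \<Longrightarrow> 0 < t \<Longrightarrow> t < q \<Longrightarrow> dist (y + t *\<^sub>R v) x < d"
proof -
  have nv: "1 + norm v > 0" by (simp add: add_pos_nonneg)
  define q where "q = d / (1 + norm v)"
  have q: "q > 0" "q * (1 + norm v) = d" using assms nv by (simp_all add: q_def)
  have qd: "q + q * norm v = d" using q(2) by (simp add: distrib_left)
  have "dist (y + t *\<^sub>R v) x < d" if "dist y x < q" "0 < t" "t < q" for y t
  proof -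
    have "dist (y + t *\<^sub>R v) x \<le> t * norm v + dist y x"
      using dist_triangle[of "y + t *\<^sub>R v" x y] that by (simp add: dist_norm)
    moreover have "t * norm v \<le> q * norm v" using that by (intro mult_right_mono) auto
    ultimately show ?thesis using that qd by linarith
  qed
  moreover have "q \<le> d"
  proof -
    have "0 \<le> q * norm v" using q(1) by simp
    then show ?thesis using qd by linarith
  qed
  ultimately show ?thesis using that q(1) by blast
qed

text \<open>The increment is split at \<open>y + t *\<^sub>R v\<close>. That this point is again an
  admissible base point is what makes the Clarke derivative subadditive in the direction.\<close>

lemma dir_bound_add:
  assumes "dir_bound g x u c" "dir_bound g x v c'"
  shows "dir_bound g x (u + v) (c + c')"
proof -
  obtain d where d: "d > 0"
    "\<And>y t. dist y x < d \<Longrightarrow> 0 < t \<Longrightarrow> t < d \<Longrightarrow> g (y + t *\<^sub>R u) - g y \<le> c * t"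
    using assms(1) unfolding dir_bound_def by blast
  obtain d' where d': "d' > 0"
    "\<And>y t. dist y x < d' \<Longrightarrow> 0 < t \<Longrightarrow> t < d' \<Longrightarrow> g (y + t *\<^sub>R v) - g y \<le> c' * t"
    using assms(2) unfolding dir_bound_def by blast
  obtain q where q: "q > 0" "q \<le> d"
    "\<And>y t. dist y x < q \<Longrightarrow> 0 < t \<Longrightarrow> t < q \<Longrightarrow> dist (y + t *\<^sub>R v) x < d"
    using small_step_in_ball[OF d(1)] by blast
  show ?thesis
  proof (rule dir_boundI[of "min q d'"])
    fix y t assume yt: "dist y x < min q d'" "0 < t" "t < min q d'"
    have "g ((y + t *\<^sub>R v) + t *\<^sub>R u) - g (y + t *\<^sub>R v) \<le> c * t"
      using d(2) q yt by simp
    moreover have "g (y + t *\<^sub>R v) - g y \<le> c' * t"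
      using d'(2) yt by simp
    ultimately show "g (y + t *\<^sub>R (u + v)) - g y \<le> (c + c') * t"
      by (simp add: algebra_simps)
  qed (use q d' in simp)
qed

lemma dir_bound_scale:
  assumes "dir_bound g x u c" "l > 0"
  shows "dir_bound g x (l *\<^sub>R u) (l * c)"
proof -
  obtain d where d: "d > 0"
    "\<And>y t. dist y x < d \<Longrightarrow> 0 < t \<Longrightarrow> t < d \<Longrightarrow> g (y + t *\<^sub>R u) - g y \<le> c * t"
    using assms(1) unfolding dir_bound_def by blast
  show ?thesis
  \<comment> \<open>Step \<open>t\<close> along \<open>l *\<^sub>R u\<close> is step
    \<open>t * l\<close> along \<open>u\<close>: the radius \<open>d\<close> limits the base points
    and \<open>d / l\<close> the steps.\<close>
  proof (rule dir_boundI[of "min d (d / l)"])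
    fix y t assume yt: "dist y x < min d (d / l)" "0 < t" "t < min d (d / l)"
    then have "t * l < d" "0 < t * l" using assms(2) by (auto simp: pos_less_divide_eq)
    then have "g (y + (t * l) *\<^sub>R u) - g y \<le> c * (t * l)" using d(2) yt by simp
    then show "g (y + t *\<^sub>R (l *\<^sub>R u)) - g y \<le> (l * c) * t" by (simp add: mult_ac)
  qed (use d assms in simp)
qed

lemma dir_bound_lipschitz:
  assumes "L-lipschitz_on (ball x d) g" "d > 0"
  shows "dir_bound g x v (L * norm v)"
proof -
  obtain q where q: "q > 0" "q \<le> d"
    "\<And>y t. dist y x < q \<Longrightarrow> 0 < t \<Longrightarrow> t < q \<Longrightarrow> dist (y + t *\<^sub>R v) x < d"
    using small_step_in_ball[OF assms(2)] by blast
  show ?thesis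
  proof (rule dir_boundI[OF q(1)])
    fix y t assume yt: "dist y x < q" "0 < t" "t < q"
    then have "dist (g (y + t *\<^sub>R v)) (g y) \<le> L * dist (y + t *\<^sub>R v) y"
      using q by (intro lipschitz_onD[OF assms(1)]) (auto simp: dist_commute)
    then show "g (y + t *\<^sub>R v) - g y \<le> L * norm v * t"
      using yt by (simp add: dist_norm mult_ac)
  qed
qed

lemma clarke_dirderiv_le:
  assumes "dir_bound g x v c"
  shows "clarke_dirderiv g x v \<le> ereal c"
proof -
  obtain d where d: "d > 0"
    "\<And>y t. dist y x < d \<Longrightarrow> 0 < t \<Longrightarrow> t < d \<Longrightarrow> g (y + t *\<^sub>R v) - g y \<le> c * t"
    using assms unfolding dir_bound_def by blast
  have "\<forall>\<^sub>F y in nhds x. dist y x < d" using d(1) eventually_nhds_metric by blast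
  moreover have "\<forall>\<^sub>F t in at_right 0. 0 < t \<and> t < d"
    using d(1) eventually_at_right_field by blast
  ultimately have "\<forall>\<^sub>F p in nhds x \<times>\<^sub>F at_right 0.
      (case p of (y, t) \<Rightarrow> ereal ((g (y + t *\<^sub>R v) - g y) / t)) \<le> ereal c"
    unfolding eventually_prod_filter
    by (intro exI[of _ "\<lambda>y. dist y x < d"] exI[of _ "\<lambda>t. 0 < t \<and> t < d"])
       (auto simp: pos_divide_le_eq d)
  then show ?thesis unfolding clarke_dirderiv_def by (rule Limsup_bounded)
qed

text \<open>Strictness matters: an upper limit equal to \<open>c\<close> allows quotients slightly
  above \<open>c\<close> arbitrarily close to \<open>x\<close>.\<close>

lemma dir_bound_if_clarke_dirderiv_less:
  assumes "clarke_dirderiv g x v < ereal c"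
  shows "dir_bound g x v c"
proof -
  have "\<forall>\<^sub>F p in nhds x \<times>\<^sub>F at_right 0.
      (case p of (y, t) \<Rightarrow> ereal ((g (y + t *\<^sub>R v) - g y) / t)) < ereal c"
    using Limsup_lessD assms unfolding clarke_dirderiv_def by blast
  then obtain P Q where PQ: "eventually P (nhds x)" "eventually Q (at_right (0::real))"
    "\<And>y t. P y \<Longrightarrow> Q t \<Longrightarrow> (g (y + t *\<^sub>R v) - g y) / t < c"
    unfolding eventually_prod_filter by auto
  obtain d where d: "d > 0" "\<And>y. dist y x < d \<Longrightarrow> P y"
    using PQ(1) unfolding eventually_nhds_metric by blast
  obtain d' where d': "d' > 0" "\<And>t. 0 < t \<Longrightarrow> t < d' \<Longrightarrow> Q t"
    using PQ(2) unfolding eventually_at_right_field by auto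
  show ?thesis
  proof (rule dir_boundI[of "min d d'"])
    fix y t assume yt: "dist y x < min d d'" "0 < t" "t < min d d'"
    then have "(g (y + t *\<^sub>R v) - g y) / t < c" using PQ(3) d d' by simp
    then show "g (y + t *\<^sub>R v) - g y \<le> c * t" using yt by (simp add: pos_divide_less_eq)
  qed (use d d' in simp)
qed

text \<open>The Clarke derivative is the infimum of the admissible \<open>c\<close>, so if
  \<open>\<xi> \<bullet> v\<close> exceeded it, a real number strictly in between would be
  admissible and yield a contradiction. The gradient thereby becomes an intersection of closed
  half-spaces.\<close>

lemma clarke_gradient_iff:
  "\<xi> \<in> clarke_gradient g x \<longleftrightarrow> (\<forall>v c. dir_bound g x v c \<longrightarrow> \<xi> \<bullet> v \<le> c)"
proof
  assume "\<xi> \<in> clarke_gradient g x"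
  then show "\<forall>v c. dir_bound g x v c \<longrightarrow> \<xi> \<bullet> v \<le> c"
    unfolding clarke_gradient_def by (metis clarke_dirderiv_le ereal_less_eq(3) mem_Collect_eq order_trans)
next
  assume R: "\<forall>v c. dir_bound g x v c \<longrightarrow> \<xi> \<bullet> v \<le> c"
  have "ereal (\<xi> \<bullet> v) \<le> clarke_dirderiv g x v" for v
  proof (rule ccontr)
    assume "\<not> ?thesis"
    then have "clarke_dirderiv g x v < ereal (\<xi> \<bullet> v)" by simp
    from ereal_dense2[OF this] obtain c
      where c: "clarke_dirderiv g x v < ereal c" "ereal c < ereal (\<xi> \<bullet> v)" by blast
    have "\<xi> \<bullet> v \<le> c" using R dir_bound_if_clarke_dirderiv_less[OF c(1)] by blast
    then show False using c(2) by simp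
  qed
  then show "\<xi> \<in> clarke_gradient g x" unfolding clarke_gradient_def by simp
qed

lemma convex_clarke_gradient: "convex (clarke_gradient g x)"
proof -
  have "clarke_gradient g x = (\<Inter>v. \<Inter>c\<in>{c. dir_bound g x v c}. {\<xi>. v \<bullet> \<xi> \<le> c})"
    by (auto simp: clarke_gradient_iff inner_commute)
  then show ?thesis by (auto intro!: convex_INT convex_halfspace_le)
qed

lemma closed_clarke_gradient: "closed (clarke_gradient g x)"
proof -
  have "clarke_gradient g x = (\<Inter>v. \<Inter>c\<in>{c. dir_bound g x v c}. {\<xi>. v \<bullet> \<xi> \<le> c})"
    by (auto simp: clarke_gradient_iff inner_commute)
  then show ?thesis by (auto intro!: closed_INT closed_halfspace_le)
qed

lemma norm_clarke_gradient_le: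
  assumes "L-lipschitz_on (ball x d) g" "d > 0" "\<xi> \<in> clarke_gradient g x"
  shows "norm \<xi> \<le> L"
proof (cases "\<xi> = 0")
  case True
  then show ?thesis using lipschitz_on_nonneg[OF assms(1)] by simp
next
  case False
  \<comment> \<open>The direction tested is \<open>\<xi>\<close> itself.\<close>
  have "\<xi> \<bullet> \<xi> \<le> L * norm \<xi>"
    using assms dir_bound_lipschitz clarke_gradient_iff by blast
  then have "norm \<xi> * norm \<xi> \<le> L * norm \<xi>"
    by (simp add: dot_square_norm power2_eq_square)
  then show ?thesis using False by (simp add: mult_le_cancel_right)
qed

text \<open>A bound \<open>c\<close> for the derivative at the limit \<open>x\<close> is also a
  bound at every \<open>z k\<close> close to \<open>x\<close>, so the inequalities defining the
  gradients at \<open>z k\<close> pass to the limit.\<close>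

lemma clarke_gradient_closed_graph:
  assumes "z \<longlonglongrightarrow> x" "\<xi> \<longlonglongrightarrow> \<zeta>" "\<And>k::nat. \<xi> k \<in> clarke_gradient g (z k)"
  shows "\<zeta> \<in> clarke_gradient g x"
  unfolding clarke_gradient_iff
proof (intro allI impI)
  fix v c assume "dir_bound g x v c"
  then obtain d where d: "d > 0" "\<And>z. dist z x < d \<Longrightarrow> dir_bound g z v c"
    using dir_bound_nearby by blast
  have "\<forall>\<^sub>F k in sequentially. dist (z k) x < d" using assms(1) d(1) by (rule tendstoD)
  then have "\<forall>\<^sub>F k in sequentially. \<xi> k \<bullet> v \<le> c"
    by eventually_elim (use d assms(3) clarke_gradient_iff in blast)
  moreover have "(\<lambda>k. \<xi> k \<bullet> v) \<longlonglongrightarrow> \<zeta> \<bullet> v" by (intro tendsto_intros assms(2))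
  ultimately show "\<zeta> \<bullet> v \<le> c" by (simp add: tendsto_upperbound)
qed

section \<open>Local boundedness and semicontinuity of the Clarke gradient\<close>

lemma locally_lipschitz_ball:
  assumes "locally_lipschitz_on X g" "open X" "x \<in> X"
  obtains d L where "d > 0" "ball x d \<subseteq> X" "L-lipschitz_on (ball x d) g"
proof -
  obtain u L where u: "u > 0" "L-lipschitz_on (cball x u \<inter> X) g"
    using assms unfolding locally_lipschitz_on_def by blast
  obtain d where d: "d > 0" "ball x d \<subseteq> X" using assms open_contains_ball by blast
  have "ball x (min d u) \<subseteq> cball x u \<inter> X" using d by auto
  then have "L-lipschitz_on (ball x (min d u)) g" using u lipschitz_on_subset by blast
  moreover have "min d u > 0" "ball x (min d u) \<subseteq> X" using d u by auto
  ultimately show ?thesis using that by blast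
qed

lemma clarke_gradient_locally_bounded:
  assumes "locally_lipschitz_on X g" "open X" "x \<in> X"
  obtains d L where "d > 0" "\<And>z \<xi>. dist z x < d \<Longrightarrow> \<xi> \<in> clarke_gradient g z \<Longrightarrow> norm \<xi> \<le> L"
proof -
  obtain d L where d: "d > 0" "L-lipschitz_on (ball x d) g"
    using locally_lipschitz_ball[OF assms] by metis
  have "norm \<xi> \<le> L" if "dist z x < d / 2" "\<xi> \<in> clarke_gradient g z" for z \<xi>
  proof (rule norm_clarke_gradient_le)
    have "ball z (d / 2) \<subseteq> ball x d"
    proof
      fix y assume "y \<in> ball z (d / 2)"
      then show "y \<in> ball x d"
        using that dist_triangle[of x y z] by (simp add: dist_commute)
    qed
    then show "L-lipschitz_on (ball z (d / 2)) g" using d lipschitz_on_subset by blast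
  qed (use d that in auto)
  then show ?thesis using that[of "d / 2" L] d by auto
qed

lemma compact_clarke_gradient:
  fixes g :: "'a::euclidean_space \<Rightarrow> real"
  assumes "locally_lipschitz_on X g" "open X" "x \<in> X"
  shows "compact (clarke_gradient g x)"
proof -
  obtain d L where d: "d > 0" "\<And>z \<xi>. dist z x < d \<Longrightarrow> \<xi> \<in> clarke_gradient g z \<Longrightarrow> norm \<xi> \<le> L"
    using clarke_gradient_locally_bounded[OF assms] by metis
  then have "bounded (clarke_gradient g x)"
    unfolding bounded_iff by (metis dist_self)
  then show ?thesis by (simp add: compact_eq_bounded_closed closed_clarke_gradient)
qed

lemma clarke_gradient_bounded_on_compact:
  assumes "locally_lipschitz_on X g" "open X" "K \<subseteq> X" "compact K"
  obtains L where "\<And>z \<xi>. z \<in> K \<Longrightarrow> \<xi> \<in> clarke_gradient g z \<Longrightarrow> norm \<xi> \<le> L"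
proof -
  have "\<forall>x\<in>K. \<exists>d L. d > 0 \<and> (\<forall>z \<xi>. dist z x < d \<longrightarrow> \<xi> \<in> clarke_gradient g z \<longrightarrow> norm \<xi> \<le> L)"
    using clarke_gradient_locally_bounded[OF assms(1,2)] assms(3) by (metis subsetD)
  then obtain d L where dL: "\<And>x. x \<in> K \<Longrightarrow> d x > 0"
    "\<And>x z \<xi>. x \<in> K \<Longrightarrow> dist z x < d x \<Longrightarrow> \<xi> \<in> clarke_gradient g z \<Longrightarrow> norm \<xi> \<le> L x"
    by metis
  obtain C where C: "C \<subseteq> K" "finite C" "K \<subseteq> (\<Union>c\<in>C. ball c (d c))"
  proof (rule compactE_image[OF assms(4), of K "\<lambda>x. ball x (d x)"])
    show "K \<subseteq> (\<Union>c\<in>K. ball c (d c))" using dL(1) by force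
  qed auto
  show ?thesis
  proof
    fix z \<xi> assume z: "z \<in> K" "\<xi> \<in> clarke_gradient g z"
    then obtain c where c: "c \<in> C" "dist z c < d c" using C by (auto simp: dist_commute)
    then have "norm \<xi> \<le> L c" using dL(2) C z by blast
    also have "L c \<le> \<bar>L c\<bar>" by simp
    also have "\<dots> \<le> (\<Sum>c\<in>C. \<bar>L c\<bar>)" using c C by (intro member_le_sum) auto
    finally show "norm \<xi> \<le> (\<Sum>c\<in>C. \<bar>L c\<bar>)" .
  qed
qed

text \<open>Otherwise some gradients at points tending to \<open>x\<close> stay
  \<open>\<epsilon>\<close>-far from the gradient set at \<open>x\<close>; local boundedness gives
  them a limit, which the closed graph places in that set.\<close>

lemma clarke_gradient_upper_semicontinuous:
  fixes g :: "'a::euclidean_space \<Rightarrow> real"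
  assumes "locally_lipschitz_on X g" "open X" "x \<in> X" "\<epsilon> > 0"
  obtains d where "d > 0"
    "\<And>z \<xi>. dist z x < d \<Longrightarrow> \<xi> \<in> clarke_gradient g z \<Longrightarrow> \<exists>\<zeta>\<in>clarke_gradient g x. norm (\<xi> - \<zeta>) \<le> \<epsilon>"
proof (rule ccontr)
  assume "\<not> thesis"
  then have "\<forall>n. \<exists>z \<xi>. dist z x < 1 / real (Suc n) \<and> \<xi> \<in> clarke_gradient g z \<and>
     (\<forall>\<zeta>\<in>clarke_gradient g x. norm (\<xi> - \<zeta>) > \<epsilon>)"
    using that by (metis not_le of_nat_0_less_iff zero_less_Suc zero_less_divide_1_iff)
  then obtain z \<xi> where z: "\<And>n. dist (z n) x < 1 / real (Suc n)"
    and \<xi>: "\<And>n. \<xi> n \<in> clarke_gradient g (z n)"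
    and far: "\<And>n \<zeta>. \<zeta>\<in>clarke_gradient g x \<Longrightarrow> norm (\<xi> n - \<zeta>) > \<epsilon>" by metis
  have zx: "z \<longlonglongrightarrow> x"
  proof (rule metric_tendsto_imp_tendsto)
    show "(\<lambda>n. 1 / real (Suc n)) \<longlonglongrightarrow> 0" by (rule LIMSEQ_Suc[OF lim_1_over_n])
    show "\<forall>\<^sub>F n in sequentially. dist (z n) x \<le> dist (1 / real (Suc n)) 0"
      using z less_imp_le by (intro always_eventually) (auto intro: less_imp_le simp: dist_real_def)
  qed
  obtain d L where d: "d > 0" "\<And>z \<xi>. dist z x < d \<Longrightarrow> \<xi> \<in> clarke_gradient g z \<Longrightarrow> norm \<xi> \<le> L"
    using clarke_gradient_locally_bounded[OF assms(1-3)] by metis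
  obtain N where N: "\<And>n. n \<ge> N \<Longrightarrow> dist (z n) x < d"
    using tendstoD[OF zx d(1)] unfolding eventually_sequentially by blast
  have "\<xi> (n + N) \<in> cball 0 L" for n
    using d(2)[OF N \<xi>, of "n + N"] by simp
  then obtain l s where s: "strict_mono s" "((\<lambda>n. \<xi> (n + N)) \<circ> s) \<longlonglongrightarrow> l"
    using compact_cball[of 0 L] unfolding compact_def by metis
  have "l \<in> clarke_gradient g x"
  proof (rule clarke_gradient_closed_graph)
    show "((\<lambda>n. z (n + N)) \<circ> s) \<longlonglongrightarrow> x"
      by (rule LIMSEQ_subseq_LIMSEQ[OF LIMSEQ_ignore_initial_segment[OF zx] s(1)])
  qed (use s \<xi> in auto)
  moreover have "\<forall>\<^sub>F n in sequentially. dist (\<xi> (s n + N)) l < \<epsilon>"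
    using tendstoD[OF s(2) assms(4)] by simp
  then obtain n where "dist (\<xi> (s n + N)) l < \<epsilon>" by (meson eventually_happens' sequentially_bot)
  ultimately show False using far by (smt (verit) dist_norm)
qed

text \<open>Counterexamples \<open>w n\<close> are normalised, and their directions converge along a
  subsequence to a unit vector \<open>u\<close>. Replacing the direction by \<open>u\<close> at the
  same distance costs at most \<open>L * norm (sgn (w n) - u)\<close> in the difference quotient, so
  the derivative along \<open>u\<close> would be at most
  \<open>snd l \<bullet> u - \<epsilon>\<close>. Regularity makes it the Clarke derivative, which is
  at least \<open>snd l \<bullet> u\<close>. The radius \<open>d\<close> is uniform in
  \<open>\<xi>\<close>.\<close>

lemma clarke_regular_lower_bound:
  fixes g :: "'a::euclidean_space \<Rightarrow> real"
  assumes "locally_lipschitz_on X g" "open X" "x \<in> X" "clarke_regular_on X g" "\<epsilon> > 0"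
  obtains d where "d > 0"
    "\<And>w \<xi>. norm w < d \<Longrightarrow> \<xi> \<in> clarke_gradient g x \<Longrightarrow> g (x + w) - g x \<ge> \<xi> \<bullet> w - \<epsilon> * norm w"
proof (rule ccontr)
  assume "\<not> thesis"
  then have "\<forall>n. \<exists>w \<xi>. norm w < 1 / real (Suc n) \<and> \<xi> \<in> clarke_gradient g x \<and>
     g (x + w) - g x < \<xi> \<bullet> w - \<epsilon> * norm w"
    using that by (metis not_le of_nat_0_less_iff zero_less_Suc zero_less_divide_1_iff)
  then obtain w \<xi> where w: "\<And>n. norm (w n) < 1 / real (Suc n)"
    and \<xi>: "\<And>n. \<xi> n \<in> clarke_gradient g x"
    and less: "\<And>n. g (x + w n) - g x < \<xi> n \<bullet> w n - \<epsilon> * norm (w n)" by metis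
  have w0: "w n \<noteq> 0" for n using less[of n] by auto
  have nw0: "(\<lambda>n. norm (w n)) \<longlonglongrightarrow> 0"
    by (rule tendsto_sandwich[OF _ _ tendsto_const LIMSEQ_Suc[OF lim_1_over_n]])
       (use w less_imp_le in \<open>auto intro!: always_eventually\<close>)
  \<comment> \<open>Pairing direction and gradient lets one subsequence serve both.\<close>
  define p where "p n = (sgn (w n), \<xi> n)" for n
  have "compact (sphere (0::'a) 1 \<times> clarke_gradient g x)"
    by (intro compact_Times compact_clarke_gradient[OF assms(1-3)]) simp
  moreover have "\<And>n. p n \<in> sphere (0::'a) 1 \<times> clarke_gradient g x"
    using w0 \<xi> by (auto simp: p_def norm_sgn)
  ultimately obtain l s where l: "l \<in> sphere (0::'a) 1 \<times> clarke_gradient g x"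
    and s: "strict_mono s" "(p \<circ> s) \<longlonglongrightarrow> l"
    unfolding compact_def by metis
  define u where "u = fst l"
  have u: "(\<lambda>n. sgn (w (s n))) \<longlonglongrightarrow> u" and \<xi>l: "(\<lambda>n. \<xi> (s n)) \<longlonglongrightarrow> snd l"
    using tendsto_fst[OF s(2)] tendsto_snd[OF s(2)] by (simp_all add: p_def u_def o_def)
  obtain D where D: "((\<lambda>t. (g (x + t *\<^sub>R u) - g x) / t) \<longlongrightarrow> D) (at_right 0)"
    "ereal D = clarke_dirderiv g x u"
    using assms(3,4) unfolding clarke_regular_on_def by blast
  have Dl: "snd l \<bullet> u \<le> D"
  proof -
    have "snd l \<in> clarke_gradient g x" using l by auto
    then have "ereal (snd l \<bullet> u) \<le> ereal D" unfolding D(2) clarke_gradient_def by blast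
    then show ?thesis by simp
  qed
  have nws: "(\<lambda>n. norm (w (s n))) \<longlonglongrightarrow> 0"
    using LIMSEQ_subseq_LIMSEQ[OF nw0 s(1)] by (simp add: o_def)
  have "filterlim (\<lambda>n. norm (w (s n))) (at_right 0) sequentially"
    unfolding filterlim_at using nws w0 by (auto intro!: always_eventually)
  from filterlim_compose[OF D(1) this]
  have lim: "(\<lambda>n. (g (x + norm (w (s n)) *\<^sub>R u) - g x) / norm (w (s n))) \<longlonglongrightarrow> D" .
  obtain d L where d: "d > 0" "L-lipschitz_on (ball x d) g"
    using locally_lipschitz_ball[OF assms(1-3)] by metis
  have ev: "\<forall>\<^sub>F n in sequentially. (g (x + norm (w (s n)) *\<^sub>R u) - g x) / norm (w (s n))
     \<le> \<xi> (s n) \<bullet> sgn (w (s n)) - \<epsilon> + L * norm (sgn (w (s n)) - u)"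
    using tendstoD[OF nws d(1)]
  proof eventually_elim
    case (elim n)
    define t where "t = norm (w (s n))"
    have t: "t > 0" "w (s n) = t *\<^sub>R sgn (w (s n))" "t < d"
      using w0[of "s n"] elim by (auto simp: t_def sgn_div_norm)
    have "norm u = 1" using l by (auto simp: u_def)
    then have "x + t *\<^sub>R u \<in> ball x d" "x + w (s n) \<in> ball x d"
      using t by (auto simp: dist_norm t_def)
    from lipschitz_onD[OF d(2) this]
    have "\<bar>g (x + t *\<^sub>R u) - g (x + w (s n))\<bar> \<le> L * norm (t *\<^sub>R u - t *\<^sub>R sgn (w (s n)))"
      using t(2) by (simp add: dist_norm)
    also have "\<dots> = t * (L * norm (sgn (w (s n)) - u))"
      using t(1) by (simp add: scaleR_diff_right[symmetric] norm_minus_commute)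
    finally have "g (x + t *\<^sub>R u) - g x \<le> (\<xi> (s n) \<bullet> w (s n) - \<epsilon> * t) + t * (L * norm (sgn (w (s n)) - u))"
      using less[of "s n"] by (simp add: t_def)
    also have "\<xi> (s n) \<bullet> w (s n) = t * (\<xi> (s n) \<bullet> sgn (w (s n)))"
      by (subst t(2)) simp
    finally have "g (x + t *\<^sub>R u) - g x \<le> (\<xi> (s n) \<bullet> sgn (w (s n)) - \<epsilon> + L * norm (sgn (w (s n)) - u)) * t"
      by (simp add: algebra_simps)
    then have "(g (x + t *\<^sub>R u) - g x) / t \<le> \<xi> (s n) \<bullet> sgn (w (s n)) - \<epsilon> + L * norm (sgn (w (s n)) - u)"
      using t(1) by (simp only: pos_divide_le_eq)
    then show ?case by (simp add: t_def)
  qed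
  have "(\<lambda>n. \<xi> (s n) \<bullet> sgn (w (s n)) - \<epsilon> + L * norm (sgn (w (s n)) - u))
     \<longlonglongrightarrow> snd l \<bullet> u - \<epsilon> + L * norm (u - u)"
    by (intro tendsto_intros \<xi>l u)
  from tendsto_le[OF sequentially_bot this lim ev] have "D \<le> snd l \<bullet> u - \<epsilon>" by simp
  then show False using Dl assms(5) by simp
qed

subsection \<open>Optimality conditions and normal cones of boxes\<close>

text \<open>Dividing by \<open>t\<close> and letting it decrease to 0 removes the quadratic term.
  This turns minimality of a proximal point into a first-order inequality.\<close>

lemma le_if_le_plus_quadratic:
  fixes p q c :: real
  assumes "d > 0" and le: "\<And>t. 0 < t \<Longrightarrow> t < d \<Longrightarrow> t * p - t\<^sup>2 * q \<le> c * t"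
  shows "p \<le> c"
proof (rule field_le_epsilon)
  fix e :: real assume "e > 0"
  define t where "t = min (d / 2) (e / (\<bar>q\<bar> + 1))"
  have "e / (\<bar>q\<bar> + 1) > 0" using \<open>e > 0\<close> by (intro divide_pos_pos) auto
  then have t: "t > 0" "t < d" "t \<le> e / (\<bar>q\<bar> + 1)" using assms(1) unfolding t_def by linarith+
  have "t * p - t\<^sup>2 * q \<le> c * t" using le t by simp
  then have "t * p \<le> t * (c + t * q)" by (simp add: power2_eq_square algebra_simps)
  then have "p \<le> c + t * q" using t(1) by simp
  also have "t * q \<le> t * (\<bar>q\<bar> + 1)" using t(1) by (intro mult_left_mono) auto
  also have "\<dots> \<le> e" using t(3) by (simp add: pos_le_divide_eq)
  finally show "p \<le> c + e" by simp
qed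

lemma prox_point_slope:
  fixes x u w :: "'a::real_inner"
  assumes "\<gamma> > 0"
    and "g x + 1 / (2 * \<gamma>) * (norm (w - x))\<^sup>2
       \<le> g (x + t *\<^sub>R u) + 1 / (2 * \<gamma>) * (norm (w - (x + t *\<^sub>R u)))\<^sup>2"
  shows "t * (((1 / \<gamma>) *\<^sub>R (w - x)) \<bullet> u) - t\<^sup>2 * ((norm u)\<^sup>2 / (2 * \<gamma>)) \<le> g (x + t *\<^sub>R u) - g x"
proof -
  have eq: "w - (x + t *\<^sub>R u) = (w - x) - t *\<^sub>R u" by simp
  have "(norm (w - (x + t *\<^sub>R u)))\<^sup>2 = (norm (w - x))\<^sup>2 - 2 * t * ((w - x) \<bullet> u) + t\<^sup>2 * (norm u)\<^sup>2"
    unfolding eq power2_norm_eq_inner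
    by (simp add: inner_diff_left inner_diff_right inner_commute power2_eq_square algebra_simps)
  then have "1 / (2 * \<gamma>) * (norm (w - (x + t *\<^sub>R u)))\<^sup>2 = 1 / (2 * \<gamma>) * (norm (w - x))\<^sup>2
     - t * ((w - x) \<bullet> u) / \<gamma> + t\<^sup>2 * ((norm u)\<^sup>2 / (2 * \<gamma>))"
    using assms(1) by (simp add: field_simps)
  moreover have "t * (((1 / \<gamma>) *\<^sub>R (w - x)) \<bullet> u) = t * ((w - x) \<bullet> u) / \<gamma>" by simp
  ultimately show ?thesis using assms(2) by linarith
qed

text \<open>Fermat's rule: openness of \<open>X\<close> makes small steps in every direction
  admissible, and the quadratic penalty has an explicit slope, so minimality bounds the increments
  of \<open>g\<close> from \<open>y\<close> below by that slope. Increments from \<open>y\<close>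
  itself are among those that \<open>dir_bound\<close> controls.\<close>

lemma prox_in_clarke_gradient:
  fixes g :: "'a::real_inner \<Rightarrow> real"
  assumes "open X" "\<gamma> > 0" "y \<in> prox X \<gamma> (\<lambda>y. ereal (g y)) w"
  shows "(1 / \<gamma>) *\<^sub>R (w - y) \<in> clarke_gradient g y" and "y \<in> X"
proof -
  show "y \<in> X" using assms(3) unfolding prox_def by simp
  have opt: "g y + 1 / (2 * \<gamma>) * (norm (w - y))\<^sup>2 \<le> g z + 1 / (2 * \<gamma>) * (norm (w - z))\<^sup>2"
    if "z \<in> X" for z using assms(3) that unfolding prox_def by simp
  show "(1 / \<gamma>) *\<^sub>R (w - y) \<in> clarke_gradient g y"
    unfolding clarke_gradient_iff
  proof (intro allI impI)
    fix u c assume "dir_bound g y u c"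
    then obtain d where d: "d > 0"
      "\<And>x t. dist x y < d \<Longrightarrow> 0 < t \<Longrightarrow> t < d \<Longrightarrow> g (x + t *\<^sub>R u) - g x \<le> c * t"
      unfolding dir_bound_def by blast
    obtain p where p: "p > 0" "ball y p \<subseteq> X"
      using assms(1) \<open>y \<in> X\<close> open_contains_ball by blast
    obtain q where q: "q > 0" "q \<le> p"
      "\<And>x t. dist x y < q \<Longrightarrow> 0 < t \<Longrightarrow> t < q \<Longrightarrow> dist (x + t *\<^sub>R u) y < p"
      using small_step_in_ball[OF p(1)] by blast
    show "((1 / \<gamma>) *\<^sub>R (w - y)) \<bullet> u \<le> c"
    proof (rule le_if_le_plus_quadratic[of "min d q"])
      fix t assume t: "0 < t" "t < min d q"
      have "y + t *\<^sub>R u \<in> X" using q(3)[of y t] q(1) t p(2) by (auto simp: dist_commute)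
      note prox_point_slope[of \<gamma> g y w t u, OF assms(2) opt[OF this]]
      also have "g (y + t *\<^sub>R u) - g y \<le> c * t" using d t by simp
      finally show "t * (((1 / \<gamma>) *\<^sub>R (w - y)) \<bullet> u) - t\<^sup>2 * ((norm u)\<^sup>2 / (2 * \<gamma>)) \<le> c * t" .
    qed (use d q in simp)
  qed
qed

text \<open>The sum rule is obtained by separating the strict epigraph of the sublinear function
  \<open>u \<mapsto> g\<degree>(x; u) - \<langle>z, u\<rangle>\<close> from \<open>(K - x) \<times> {s. s \<le> 0}\<close>.\<close>

lemma prox_convex_indicator_optimality:
  fixes g :: "'a::euclidean_space \<Rightarrow> real"
  assumes "open X" "K \<subseteq> X" "convex K" "K \<noteq> {}" "locally_lipschitz_on X g" "\<gamma> > 0"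
    and "x \<in> prox X \<gamma> (\<lambda>y. ereal (g y) + convex_indicator K y) w"
  obtains \<xi> n where "x \<in> K" "\<xi> \<in> clarke_gradient g x" "n \<in> normal_cone K x" "w = x + \<gamma> *\<^sub>R \<xi> + n"
proof -
  have le: "ereal (g x) + convex_indicator K x + ereal (1 / (2 * \<gamma>) * (norm (w - x))\<^sup>2)
    \<le> ereal (g c) + convex_indicator K c + ereal (1 / (2 * \<gamma>) * (norm (w - c))\<^sup>2)" if "c \<in> K" for c
    using assms(2,7) that unfolding prox_def by blast
  have xK: "x \<in> K"
  proof (rule ccontr)
    assume "x \<notin> K"
    moreover obtain c where "c \<in> K" using assms(4) by blast
    ultimately show False using le[of c] by (simp add: convex_indicator_def)
  qed
  have opt: "g x + 1 / (2 * \<gamma>) * (norm (w - x))\<^sup>2 \<le> g c + 1 / (2 * \<gamma>) * (norm (w - c))\<^sup>2"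
    if "c \<in> K" for c using le[OF that] xK that by (simp add: convex_indicator_def)
  define z where "z = (1 / \<gamma>) *\<^sub>R (w - x)"
  \<comment> \<open>\<open>z\<close> is the negative gradient of the quadratic penalty at
    \<open>x\<close>. The strict \<open>s' < s\<close> makes \<open>A\<close> exactly the strict
    epigraph, although \<open>dir_bound\<close> may fail at the value of the derivative.\<close>
  define A where "A = {(u, s). \<exists>s'<s. dir_bound g x u (s' + z \<bullet> u)}"
  define B where "B = ((\<lambda>c. c - x) ` K) \<times> {..(0::real)}"
  have A_I: "(u, s) \<in> A" if "dir_bound g x u c" "c - z \<bullet> u < s" for u s c
    using that unfolding A_def by (auto intro!: exI[of _ "c - z \<bullet> u"])
  have A_scale: "(l *\<^sub>R u, l * s) \<in> A" if us: "(u, s) \<in> A" "l > 0" for u s l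
  proof -
    obtain s' where "s' < s" "dir_bound g x u (s' + z \<bullet> u)" using us unfolding A_def by blast
    then have "dir_bound g x (l *\<^sub>R u) (l * (s' + z \<bullet> u))" "l * s' < l * s"
      using us dir_bound_scale by auto
    then show ?thesis by (intro A_I) (auto simp: algebra_simps)
  qed
  have A_add: "(u + v, s + r) \<in> A" if us: "(u, s) \<in> A" "(v, r) \<in> A" for u v s r
  proof -
    obtain s' r' where "s' < s" "dir_bound g x u (s' + z \<bullet> u)" "r' < r" "dir_bound g x v (r' + z \<bullet> v)"
      using us unfolding A_def by blast
    then show ?thesis
      by (intro A_I[OF dir_bound_add]) (auto simp: inner_add_right)
  qed
  have "convex A"
  proof (rule convexI)
    fix p q :: "'a \<times> real" and k l :: real
    assume pq: "p \<in> A" "q \<in> A" "0 \<le> k" "0 \<le> l" "k + l = 1"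
    show "k *\<^sub>R p + l *\<^sub>R q \<in> A"
    proof (cases "k = 0 \<or> l = 0")
      case True
      then show ?thesis using pq by auto
    next
      case False
      then show ?thesis using pq A_scale A_add by (cases p; cases q) auto
    qed
  qed
  obtain d L where d: "d > 0" "L-lipschitz_on (ball x d) g"
    using locally_lipschitz_ball[OF assms(5,1)] xK assms(2) by (metis subsetD)
  \<comment> \<open>Local Lipschitz continuity puts points of \<open>A\<close> over every direction
    \<open>u\<close>; this later excludes a vertical separating hyperplane.\<close>
  have A_lip: "(u, s) \<in> A" if "L * norm u - z \<bullet> u < s" for u s
    using A_I[OF dir_bound_lipschitz[OF d(2,1)] that] .
  have A0: "(0, s) \<in> A" if "s > 0" for s using A_lip[of 0 s] that by simp
  \<comment> \<open>A common point would give a direction \<open>c - x\<close> into \<open>K\<close>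
    along which the penalised objective decreases to first order, against minimality of
    \<open>x\<close> on the segment towards \<open>c\<close>.\<close>
  have "A \<inter> B = {}"
  proof (rule ccontr)
    assume "A \<inter> B \<noteq> {}"
    then obtain c s s' where c: "c \<in> K" "s \<le> 0" "s' < s" "dir_bound g x (c - x) (s' + z \<bullet> (c - x))"
      unfolding A_def B_def by auto
    obtain d where d: "d > 0"
      "\<And>y t. dist y x < d \<Longrightarrow> 0 < t \<Longrightarrow> t < d \<Longrightarrow> g (y + t *\<^sub>R (c - x)) - g y \<le> (s' + z \<bullet> (c - x)) * t"
      using c(4) unfolding dir_bound_def by blast
    have "z \<bullet> (c - x) \<le> s' + z \<bullet> (c - x)"
    proof (rule le_if_le_plus_quadratic[of "min d 1"])
      fix t assume t: "0 < t" "t < min d 1"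
      have "x + t *\<^sub>R (c - x) = (1 - t) *\<^sub>R x + t *\<^sub>R c" by (simp add: algebra_simps)
      then have "x + t *\<^sub>R (c - x) \<in> K"
        using assms(3) xK c(1) t by (simp add: convexD_alt)
      note prox_point_slope[of \<gamma> g x w t "c - x", OF assms(6) opt[OF this]]
      also have "g (x + t *\<^sub>R (c - x)) - g x \<le> (s' + z \<bullet> (c - x)) * t" using d t by simp
      finally show "t * (z \<bullet> (c - x)) - t\<^sup>2 * ((norm (c - x))\<^sup>2 / (2 * \<gamma>)) \<le> (s' + z \<bullet> (c - x)) * t"
        unfolding z_def .
    qed (use d in simp)
    then show False using c by simp
  qed
  moreover have "convex B" unfolding B_def
    by (intro convex_Times convex_translation_subtract assms(3)) simp
  moreover have "A \<noteq> {}" "B \<noteq> {}" using A0[of 1] xK unfolding B_def by auto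
  ultimately obtain a b where a: "a \<noteq> 0" "\<And>p. p \<in> A \<Longrightarrow> a \<bullet> p \<le> b" "\<And>p. p \<in> B \<Longrightarrow> b \<le> a \<bullet> p"
    using separating_hyperplane_sets[OF \<open>convex A\<close> \<open>convex B\<close>] by metis
  obtain q \<alpha> where qa: "a = (q, \<alpha>)" by (cases a)
  have aA: "q \<bullet> u + \<alpha> * s \<le> b" if "(u, s) \<in> A" for u s using a(2)[OF that] by (simp add: qa)
  have aB: "b \<le> q \<bullet> (c - x)" if "c \<in> K" for c using a(3)[of "(c - x, 0)"] that by (simp add: qa B_def)
  have b0: "b \<le> 0" using aB[OF xK] by simp
  have \<alpha>s: "\<alpha> * s \<le> b" if "s > 0" for s using aA[OF A0[OF that]] by simp
  have "\<alpha> \<le> 0" using \<alpha>s[of 1] b0 by simp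
  have "\<alpha> \<noteq> 0"
  proof
    assume "\<alpha> = 0"
    then have "q \<bullet> q \<le> 0" using aA[OF A_lip[of q "L * norm q - z \<bullet> q + 1"]] b0 by simp
    then have "q = 0" by (meson inner_gt_zero_iff not_le)
    then show False using a(1) qa \<open>\<alpha> = 0\<close> by (simp add: zero_prod_def)
  qed
  with \<open>\<alpha> \<le> 0\<close> have neg: "\<alpha> < 0" by simp
  have "b \<ge> 0"
  proof (rule ccontr)
    assume "\<not> b \<ge> 0"
    \<comment> \<open>At this value of \<open>s\<close> the bound \<open>\<alpha>s\<close> reads
      \<open>b / 2 \<le> b\<close>, impossible for negative \<open>b\<close>.\<close>
    then have "b / (2 * \<alpha>) > 0" using neg by (simp add: zero_less_divide_iff)
    from \<alpha>s[OF this] show False using neg \<open>\<not> b \<ge> 0\<close> by simp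
  qed
  \<comment> \<open>After normalising the vertical component, \<open>h\<close> lies below the
    sublinear function on all directions and is nonnegative on \<open>K - x\<close>. So
    \<open>h\<close> corrects \<open>z\<close> to a Clarke gradient, and its negative is normal to
    \<open>K\<close>.\<close>
  define h where "h = (1 / - \<alpha>) *\<^sub>R q"
  have q: "q \<bullet> u = (- \<alpha>) * (h \<bullet> u)" for u using neg by (simp add: h_def)
  have hA: "h \<bullet> u \<le> s" if "(u, s) \<in> A" for u s
  proof -
    have "(- \<alpha>) * (h \<bullet> u) \<le> (- \<alpha>) * s" using aA[OF that] b0 by (simp add: q)
    then show ?thesis using neg by (simp add: mult_le_cancel_left)
  qed
  show ?thesis
  proof
    show "z + h \<in> clarke_gradient g x"
      unfolding clarke_gradient_iff
    proof (intro allI impI)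
      fix u c assume u: "dir_bound g x u c"
      show "(z + h) \<bullet> u \<le> c"
      proof (rule field_le_epsilon)
        fix e :: real assume "e > 0"
        then show "(z + h) \<bullet> u \<le> c + e"
          using hA[OF A_I[OF u, of "c - z \<bullet> u + e"]] by (simp add: inner_add_left)
      qed
    qed
    show "- (\<gamma> *\<^sub>R h) \<in> normal_cone K x"
      unfolding normal_cone_def
    proof (clarify)
      fix c assume "c \<in> K"
      then have "(- \<alpha>) * (h \<bullet> (c - x)) \<ge> 0" using aB[of c] \<open>b \<ge> 0\<close> unfolding q by linarith
      then have "h \<bullet> (c - x) \<ge> 0" using neg by (auto simp: mult_le_0_iff)
      then have "\<gamma> * (h \<bullet> (c - x)) \<ge> 0" using assms(6) by simp
      then show "- (\<gamma> *\<^sub>R h) \<bullet> (x - c) \<ge> 0" by (simp add: inner_diff_right right_diff_distrib)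
    qed
    show "w = x + \<gamma> *\<^sub>R (z + h) + - (\<gamma> *\<^sub>R h)"
      using assms(6) by (simp add: z_def scaleR_add_right)
  qed (rule xK)
qed

section \<open>Normal cones, in particular those of boxes\<close>

lemma normal_cone_Inter: "normal_cone K x = (\<Inter>c\<in>K. {b. (x - c) \<bullet> b \<ge> 0})"
proof (rule set_eqI)
  fix b show "b \<in> normal_cone K x \<longleftrightarrow> b \<in> (\<Inter>c\<in>K. {b. (x - c) \<bullet> b \<ge> 0})"
  by (simp only: normal_cone_def inner_commute[of b] mem_Collect_eq INT_iff)
qed

lemma closed_normal_cone: "closed (normal_cone K x)"
  unfolding normal_cone_Inter by (intro closed_INT ballI closed_halfspace_ge)

lemma scaleR_normal_cone:
  assumes "n \<in> normal_cone K x" "l \<ge> 0"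
  shows "l *\<^sub>R n \<in> normal_cone K x"
proof -
  have "(l *\<^sub>R n) \<bullet> (x - c) \<ge> 0" if "c \<in> K" for c
    unfolding inner_scaleR_left using assms that by (intro mult_nonneg_nonneg) (auto simp: normal_cone_def)
  then show ?thesis unfolding normal_cone_def by blast
qed

lemma sum_normal_cone:
  assumes "\<And>k. k \<in> A \<Longrightarrow> n k \<in> normal_cone K x"
  shows "sum n A \<in> normal_cone K x"
proof -
  have "sum n A \<bullet> (x - c) \<ge> 0" if "c \<in> K" for c
    unfolding inner_sum_left using assms that by (intro sum_nonneg) (simp add: normal_cone_def)
  then show ?thesis unfolding normal_cone_def by blast
qed

lemma closest_point_normal_cone:
  fixes K :: "'a::euclidean_space set"
  assumes "convex K" "closed K"
  shows "w - closest_point K w \<in> normal_cone K (closest_point K w)"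
  unfolding normal_cone_def
proof (clarify)
  fix c assume "c \<in> K"
  from closest_point_dot[OF assms this, of w]
  show "(w - closest_point K w) \<bullet> (closest_point K w - c) \<ge> 0"
    by (simp add: inner_diff_right)
qed

text \<open>The coordinates of a box vary independently, so testing against points that differ from
  \<open>z\<close> in one coordinate already determines the sign conditions.\<close>

lemma normal_cone_cbox:
  fixes a b z :: "'a::euclidean_space"
  assumes "z \<in> cbox a b"
  shows "n \<in> normal_cone (cbox a b) z \<longleftrightarrow>
    (\<forall>i\<in>Basis. (n \<bullet> i > 0 \<longrightarrow> z \<bullet> i = b \<bullet> i) \<and> (n \<bullet> i < 0 \<longrightarrow> z \<bullet> i = a \<bullet> i))"
proof
  assume n: "n \<in> normal_cone (cbox a b) z"
  have key: "(n \<bullet> i) * (z \<bullet> i - s) \<ge> 0" if i: "i \<in> Basis" and s: "a \<bullet> i \<le> s" "s \<le> b \<bullet> i" for i s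
  proof -
    define c where "c = z + (s - z \<bullet> i) *\<^sub>R i"
    have "c \<bullet> j = (if j = i then s else z \<bullet> j)" if "j \<in> Basis" for j
      using i that by (auto simp: c_def inner_add_left inner_Basis)
    then have "c \<in> cbox a b" using assms s by (auto simp: mem_box)
    then have "n \<bullet> (z - c) \<ge> 0" using n unfolding normal_cone_def by blast
    then show ?thesis by (simp add: c_def algebra_simps)
  qed
  show "\<forall>i\<in>Basis. (n \<bullet> i > 0 \<longrightarrow> z \<bullet> i = b \<bullet> i) \<and> (n \<bullet> i < 0 \<longrightarrow> z \<bullet> i = a \<bullet> i)"
  proof (intro ballI conjI impI)
    fix i :: 'a assume i: "i \<in> Basis"
    have z: "a \<bullet> i \<le> z \<bullet> i" "z \<bullet> i \<le> b \<bullet> i" using assms i by (auto simp: mem_box)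
    { assume "n \<bullet> i > 0"
      then show "z \<bullet> i = b \<bullet> i" using key[OF i, of "b \<bullet> i"] z by (auto simp: zero_le_mult_iff) }
    { assume "n \<bullet> i < 0"
      then show "z \<bullet> i = a \<bullet> i" using key[OF i, of "a \<bullet> i"] z by (auto simp: zero_le_mult_iff) }
  qed
next
  assume n: "\<forall>i\<in>Basis. (n \<bullet> i > 0 \<longrightarrow> z \<bullet> i = b \<bullet> i) \<and> (n \<bullet> i < 0 \<longrightarrow> z \<bullet> i = a \<bullet> i)"
  show "n \<in> normal_cone (cbox a b) z"
    unfolding normal_cone_def
  proof (clarify)
    fix c assume c: "c \<in> cbox a b"
    have "(n \<bullet> i) * ((z - c) \<bullet> i) \<ge> 0" if i: "i \<in> Basis" for i
    proof (cases "n \<bullet> i" "0::real" rule: linorder_cases)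
      case less
      then show ?thesis using n c i
        by (intro mult_nonpos_nonpos) (auto simp: mem_box inner_diff_left)
    next
      case greater
      then show ?thesis using n c i
        by (intro mult_nonneg_nonneg) (auto simp: mem_box inner_diff_left)
    qed simp
    then show "n \<bullet> (z - c) \<ge> 0"
      by (subst euclidean_inner) (auto intro: sum_nonneg)
  qed
qed

text \<open>Constraints inactive at \<open>y\<close> stay inactive nearby, so passing from
  \<open>y\<close> to a nearby point can only shrink the cone. The inclusion is exact for normals of
  any length, which allows normals at many nearby points to be added inside one fixed cone.\<close>

lemma normal_cone_cbox_nearby:
  fixes a b y :: "'a::euclidean_space"
  assumes y: "y \<in> cbox a b"
  obtains d where "d > 0"
    "\<And>z. z \<in> cbox a b \<Longrightarrow> dist z y < d \<Longrightarrow> normal_cone (cbox a b) z \<subseteq> normal_cone (cbox a b) y"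
proof -
  have "\<forall>\<^sub>F z in nhds y. \<forall>i\<in>Basis. (y \<bullet> i < b \<bullet> i \<longrightarrow> z \<bullet> i < b \<bullet> i) \<and> (a \<bullet> i < y \<bullet> i \<longrightarrow> a \<bullet> i < z \<bullet> i)"
  proof (intro eventually_ball_finite ballI finite_Basis)
    fix i :: 'a assume "i \<in> Basis"
    have lim: "((\<lambda>z. z \<bullet> i) \<longlongrightarrow> y \<bullet> i) (nhds y)" by (intro tendsto_inner filterlim_ident tendsto_const)
    have "\<forall>\<^sub>F z in nhds y. y \<bullet> i < b \<bullet> i \<longrightarrow> z \<bullet> i < b \<bullet> i"
      using order_tendstoD(2)[OF lim] by (cases "y \<bullet> i < b \<bullet> i") auto
    moreover have "\<forall>\<^sub>F z in nhds y. a \<bullet> i < y \<bullet> i \<longrightarrow> a \<bullet> i < z \<bullet> i"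
      using order_tendstoD(1)[OF lim] by (cases "a \<bullet> i < y \<bullet> i") auto
    ultimately show "\<forall>\<^sub>F z in nhds y. (y \<bullet> i < b \<bullet> i \<longrightarrow> z \<bullet> i < b \<bullet> i) \<and> (a \<bullet> i < y \<bullet> i \<longrightarrow> a \<bullet> i < z \<bullet> i)"
      by (rule eventually_conj)
  qed
  then obtain d where d: "d > 0" "\<And>z i. dist z y < d \<Longrightarrow> i \<in> Basis \<Longrightarrow>
      (y \<bullet> i < b \<bullet> i \<longrightarrow> z \<bullet> i < b \<bullet> i) \<and> (a \<bullet> i < y \<bullet> i \<longrightarrow> a \<bullet> i < z \<bullet> i)"
    unfolding eventually_nhds_metric by blast
  show ?thesis
  proof
    fix z assume z: "z \<in> cbox a b" "dist z y < d"
    show "normal_cone (cbox a b) z \<subseteq> normal_cone (cbox a b) y"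
    proof
      fix n assume n: "n \<in> normal_cone (cbox a b) z"
      have "(n \<bullet> i > 0 \<longrightarrow> y \<bullet> i = b \<bullet> i) \<and> (n \<bullet> i < 0 \<longrightarrow> y \<bullet> i = a \<bullet> i)" if i: "i \<in> Basis" for i
      proof -
        have "(n \<bullet> i > 0 \<longrightarrow> z \<bullet> i = b \<bullet> i) \<and> (n \<bullet> i < 0 \<longrightarrow> z \<bullet> i = a \<bullet> i)"
          using n normal_cone_cbox[OF z(1)] i by blast
        moreover have "a \<bullet> i \<le> y \<bullet> i" "y \<bullet> i \<le> b \<bullet> i" using y i by (auto simp: mem_box)
        ultimately show ?thesis using d(2)[OF z(2) i] by linarith
      qed
      then show "n \<in> normal_cone (cbox a b) y" using normal_cone_cbox[OF y] by blast
    qed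
  qed (rule d)
qed

section \<open>Stationarity and its stability near a point\<close>

lemma stationary_set_iff:
  "x \<in> stationary_set K gradf g \<longleftrightarrow>
     x \<in> K \<and> (\<exists>\<xi>\<in>clarke_gradient g x. \<exists>n\<in>normal_cone K x. gradf x + \<xi> + n = 0)"
proof -
  have "0 \<in> {gradf x} + clarke_gradient g x + normal_cone K x \<longleftrightarrow>
    (\<exists>\<xi>\<in>clarke_gradient g x. \<exists>n\<in>normal_cone K x. 0 = gradf x + \<xi> + n)"
    by (simp only: set_plus_def mem_Collect_eq bex_simps singleton_iff) blast
  then show ?thesis unfolding stationary_set_def mem_Collect_eq by (simp only: eq_commute[of 0])
qed

text \<open>At \<open>x\<close> the sums of a Clarke gradient and a normal form a closed set,
  compact plus closed, so \<open>- gradf x\<close> has positive distance \<open>e\<close> from it.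
  Near \<open>x\<close> the gradient of \<open>f\<close> and the Clarke gradients each move by at
  most \<open>e / 4\<close> while the normal cone does not grow; a margin of \<open>e / 2\<close>
  survives.\<close>

lemma nonstationary_nearby:
  fixes g :: "'a::euclidean_space \<Rightarrow> real"
  assumes "open X" "cbox a b \<subseteq> X" "locally_lipschitz_on X g" "continuous_on X gradf"
    and x: "x \<in> cbox a b" "x \<notin> stationary_set (cbox a b) gradf g"
  obtains d \<rho> where "d > 0" "\<rho> > 0"
    "\<And>z \<xi> n. z \<in> cbox a b \<Longrightarrow> dist z x < d \<Longrightarrow> \<xi> \<in> clarke_gradient g z \<Longrightarrow>
       n \<in> normal_cone (cbox a b) z \<Longrightarrow> norm (gradf z + \<xi> + n) \<ge> \<rho>"
proof -
  have xX: "x \<in> X" using assms by blast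
  define C where "C = (\<Union>\<xi>\<in>clarke_gradient g x. \<Union>n\<in>normal_cone (cbox a b) x. {\<xi> + n})"
  have "closed C" unfolding C_def
    by (intro compact_closed_sums compact_clarke_gradient[OF assms(3,1) xX] closed_normal_cone)
  moreover have "- gradf x \<notin> C"
  proof
    assume "- gradf x \<in> C"
    then obtain \<xi> n where "\<xi> \<in> clarke_gradient g x" "n \<in> normal_cone (cbox a b) x" "- gradf x = \<xi> + n"
      unfolding C_def by blast
    moreover from this have "gradf x + \<xi> + n = 0" by (metis add.assoc add.right_inverse)
    ultimately show False using x unfolding stationary_set_iff by blast
  qed
  ultimately obtain e where e: "e > 0" "ball (- gradf x) e \<subseteq> - C"
    unfolding closed_open open_contains_ball by blast
  have base: "norm (gradf x + \<xi> + n) \<ge> e" if "\<xi> \<in> clarke_gradient g x" "n \<in> normal_cone (cbox a b) x" for \<xi> n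
  proof (rule ccontr)
    assume "\<not> ?thesis"
    then have "norm (- (gradf x + \<xi> + n)) < e" by (simp only: norm_minus_cancel not_le)
    moreover have "- (gradf x + \<xi> + n) = - gradf x - (\<xi> + n)" by simp
    ultimately have "dist (- gradf x) (\<xi> + n) < e" by (simp only: dist_norm)
    then have "\<xi> + n \<in> ball (- gradf x) e" by simp
    then show False using e that unfolding C_def by blast
  qed
  have e4: "e / 4 > 0" using e by simp
  obtain d1 where d1: "d1 > 0" "\<And>z \<xi>. dist z x < d1 \<Longrightarrow> \<xi> \<in> clarke_gradient g z \<Longrightarrow>
      \<exists>\<zeta>\<in>clarke_gradient g x. norm (\<xi> - \<zeta>) \<le> e / 4"
    using clarke_gradient_upper_semicontinuous[OF assms(3,1) xX e4] by metis
  obtain d2 where d2: "d2 > 0"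
    "\<And>z. z \<in> cbox a b \<Longrightarrow> dist z x < d2 \<Longrightarrow> normal_cone (cbox a b) z \<subseteq> normal_cone (cbox a b) x"
    using normal_cone_cbox_nearby[OF x(1)] by metis
  obtain d3 where d3: "d3 > 0" "\<And>z. z \<in> X \<Longrightarrow> dist z x < d3 \<Longrightarrow> dist (gradf z) (gradf x) < e / 4"
    using assms(4) xX e4 unfolding continuous_on_iff by metis
  show ?thesis
  proof
    fix z \<xi> n
    assume z: "z \<in> cbox a b" "dist z x < min d1 (min d2 d3)" "\<xi> \<in> clarke_gradient g z"
      "n \<in> normal_cone (cbox a b) z"
    obtain \<zeta> where \<zeta>: "\<zeta> \<in> clarke_gradient g x" "norm (\<xi> - \<zeta>) \<le> e / 4" using d1(2) z by force
    have "n \<in> normal_cone (cbox a b) x" using d2(2) z by force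
    then have "e \<le> norm (gradf x + \<zeta> + n)" by (rule base[OF \<zeta>(1)])
    also have "gradf x + \<zeta> + n = (gradf z + \<xi> + n) - ((gradf z - gradf x) + (\<xi> - \<zeta>))" by simp
    also have "norm \<dots> \<le> norm (gradf z + \<xi> + n) + (norm (gradf z - gradf x) + norm (\<xi> - \<zeta>))"
      by (intro order_trans[OF norm_triangle_ineq4] add_left_mono norm_triangle_ineq)
    also have "norm (gradf z - gradf x) \<le> e / 4"
      using d3(2)[of z] z assms(2) by (auto simp: dist_norm)
    finally show "norm (gradf z + \<xi> + n) \<ge> e / 2" using \<zeta>(2) by simp
  qed (use d1 d2 d3 e in auto)
qed

text \<open>By continuity there is a least time from which the claimed decrease up to
  \<open>T\<close> holds. Were it positive, the hypothesis at that time would give an earlier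
  one.\<close>

lemma continuous_decrease_if_left_decrease:
  fixes \<phi> :: "real \<Rightarrow> real"
  assumes "0 \<le> T" "continuous_on {0..T} \<phi>"
    and left: "\<And>s. 0 < s \<Longrightarrow> s \<le> T \<Longrightarrow> \<exists>d>0. \<forall>h. 0 < h \<longrightarrow> h < d \<longrightarrow> h \<le> s \<longrightarrow> \<phi> s + c * h \<le> \<phi> (s - h)"
  shows "\<phi> T + c * T \<le> \<phi> 0"
proof -
  define A where "A = {s \<in> {0..T}. \<phi> T + c * (T - s) \<le> \<phi> s}"
  have "closed A" unfolding A_def
    by (intro continuous_on_closed_Collect_le continuous_intros assms(2))
  moreover have "T \<in> A" using assms(1) by (simp add: A_def)
  moreover have bdd: "bdd_below A" unfolding A_def by (rule bdd_belowI[of _ 0]) auto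
  ultimately have m: "Inf A \<in> A" by (intro closed_contains_Inf) auto
  have "Inf A = 0"
  proof (rule ccontr)
    assume "Inf A \<noteq> 0"
    then have s: "0 < Inf A" "Inf A \<le> T" using m by (auto simp: A_def)
    then obtain d where d: "d > 0" "\<And>h. 0 < h \<Longrightarrow> h < d \<Longrightarrow> h \<le> Inf A \<Longrightarrow> \<phi> (Inf A) + c * h \<le> \<phi> (Inf A - h)"
      using left by blast
    define h where "h = min (d / 2) (Inf A)"
    have h: "0 < h" "h < d" "h \<le> Inf A" using d s by (auto simp: h_def)
    have "\<phi> T + c * (T - Inf A) \<le> \<phi> (Inf A)" using m by (simp add: A_def)
    then have "Inf A - h \<in> A"
      using d(2)[OF h] h s by (simp add: A_def algebra_simps)
    then have "Inf A \<le> Inf A - h" by (rule cInf_lower[OF _ bdd])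
    then show False using h by simp
  qed
  then show ?thesis using m by (simp add: A_def)
qed

subsection \<open>Asymptotic equicontinuity and limit curves\<close>

text \<open>A discrete one-sided Skorokhod reflection estimate, with \<open>s\<close> the
  accumulated unreflected displacement. The witness \<open>j\<close> is the last index at which the
  barrier \<open>lo\<close> is met, or \<open>m\<close> if there is none: at the barrier the path is
  not above \<open>z m\<close>, and from there on it falls at least as much as \<open>s\<close>
  grows.\<close>

lemma one_sided_reflection_bound:
  fixes s z :: "nat \<Rightarrow> real"
  assumes "m \<le> l" "\<And>k. lo \<le> z k"
    and "\<And>k. z (Suc k) > lo \<Longrightarrow> z (Suc k) \<le> z k - (s (Suc k) - s k)"
  shows "\<exists>j\<in>{m..l}. z l - z m \<le> s j - s l"
  using assms(1)
proof (induction l rule: dec_induct)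
  case base
  then show ?case by auto
next
  case (step l)
  then obtain j where j: "j \<in> {m..l}" "z l - z m \<le> s j - s l" by blast
  show ?case
  proof (cases "z (Suc l) > lo")
    case True
    then have "z (Suc l) - z m \<le> s j - s (Suc l)" using assms(3)[of l] j(2) by linarith
    then show ?thesis using j(1) by auto
  next
    case False
    then have "z (Suc l) - z m \<le> s (Suc l) - s (Suc l)" using assms(2)[of m] by simp
    then show ?thesis using step by (intro bexI[of _ "Suc l"]) auto
  qed
qed

text \<open>Indices are shifted: \<open>\<gamma> k\<close> is the step size leading from
  \<open>x k\<close> to \<open>x (Suc k)\<close>. The point \<open>y k\<close> is where the Clarke
  gradient is taken, and the normal \<open>n k\<close> carries no factor \<open>\<gamma> k\<close>
  and no size bound.\<close>

locale proximal_path =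
  fixes a b :: "'a::euclidean_space" and X :: "'a set" and f g :: "'a \<Rightarrow> real"
    and gradf :: "'a \<Rightarrow> 'a" and \<gamma> :: "nat \<Rightarrow> real" and x y v n r e :: "nat \<Rightarrow> 'a" and L :: real
  assumes open_X: "open X" and box_X: "cbox a b \<subseteq> X"
    and f_grad: "\<And>z. z \<in> X \<Longrightarrow> GDERIV f z :> gradf z"
    and f_C1: "continuous_on X gradf"
    and g_lip: "locally_lipschitz_on X g"
    and g_regular: "clarke_regular_on X g"
    and \<gamma>_pos: "\<And>k. \<gamma> k > 0"
    and \<gamma>_lim: "\<gamma> \<longlonglongrightarrow> 0"
    and \<gamma>_sum: "filterlim (\<lambda>m. \<Sum>k<m. \<gamma> k) at_top sequentially"
    and x_box: "\<And>k. x k \<in> cbox a b"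
    and step: "\<And>k. x (Suc k) = x k - \<gamma> k *\<^sub>R (gradf (x k) + v k + r k + e k) - n k"
    and n_normal: "\<And>k. n k \<in> normal_cone (cbox a b) (x (Suc k))"
    and v_gradient: "\<And>k. v k \<in> clarke_gradient g (y k)"
    and v_bound: "\<And>k. norm (v k) \<le> L"
    and y_near: "(\<lambda>k. y k - x (Suc k)) \<longlonglongrightarrow> 0"
    and r_lim: "r \<longlonglongrightarrow> 0"
    and e_sum: "convergent (\<lambda>m. \<Sum>k<m. \<gamma> k *\<^sub>R e k)"
begin

section \<open>Time scale, noise and the asymptotic Lipschitz property\<close>

definition time :: "nat \<Rightarrow> real" where "time m = (\<Sum>k<m. \<gamma> k)"
definition noise :: "nat \<Rightarrow> 'a" where "noise m = (\<Sum>k<m. \<gamma> k *\<^sub>R e k)"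
definition drift :: "nat \<Rightarrow> 'a" where "drift k = gradf (x k) + v k + r k"

lemma time_Suc: "time (Suc m) = time m + \<gamma> m" by (simp add: time_def)

lemma time_mono:
  assumes "m \<le> l"
  shows "time m \<le> time l"
proof (rule lift_Suc_mono_le[OF _ assms])
  show "time k \<le> time (Suc k)" for k using \<gamma>_pos[of k] by (simp add: time_Suc)
qed

lemma time_diff:
  assumes "m \<le> l"
  shows "time l - time m = (\<Sum>k=m..<l. \<gamma> k)"
  unfolding time_def atLeast0LessThan[symmetric] by (rule sum_diff_nat_ivl[OF le0 assms])

lemma noise_Cauchy:
  assumes "\<epsilon> > 0"
  obtains M where "\<And>m l. m \<ge> M \<Longrightarrow> l \<ge> M \<Longrightarrow> norm (noise l - noise m) < \<epsilon>"
proof -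
  have "Cauchy noise" using convergent_Cauchy[OF e_sum] unfolding noise_def[abs_def] .
  from metric_CauchyD[OF this assms] obtain M where
    "\<forall>m\<ge>M. \<forall>l\<ge>M. dist (noise m) (noise l) < \<epsilon>" by blast
  then show ?thesis using that[of M] by (simp add: dist_norm)
qed

lemma increment:
  assumes "m \<le> l"
  shows "x m - x l = (\<Sum>k=m..<l. \<gamma> k *\<^sub>R drift k) + (noise l - noise m) + (\<Sum>k=m..<l. n k)"
  using assms
proof (induction l rule: dec_induct)
  case base
  then show ?case by simp
next
  case (step l)
  have "x m - x (Suc l) = (x m - x l) + (x l - x (Suc l))" by simp
  also have "x l - x (Suc l) = \<gamma> l *\<^sub>R drift l + \<gamma> l *\<^sub>R e l + n l"
    using proximal_path.step[OF proximal_path_axioms, of l] by (simp add: drift_def algebra_simps)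
  also have "noise (Suc l) = noise l + \<gamma> l *\<^sub>R e l" by (simp add: noise_def)
  ultimately show ?case using step by (simp add: algebra_simps)
qed

lemma drift_bounded: obtains C where "C \<ge> 0" "\<And>k. norm (drift k) \<le> C"
proof -
  have "compact (gradf ` cbox a b)"
    using continuous_on_subset[OF f_C1 box_X] by (intro compact_continuous_image) auto
  from compact_imp_bounded[OF this] obtain B where B: "\<And>z. z \<in> cbox a b \<Longrightarrow> norm (gradf z) \<le> B"
    unfolding bounded_iff by auto
  have "Bseq r" by (rule convergent_imp_Bseq[OF convergentI[OF r_lim]])
  from BseqD[OF this] obtain R where R: "\<And>k. norm (r k) \<le> R" by blast
  have "norm (drift k) \<le> B + L + R" for k
    using norm_triangle_ineq[of "gradf (x k) + v k" "r k"] norm_triangle_ineq[of "gradf (x k)" "v k"]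
      B[OF x_box[of k]] v_bound[of k] R[of k] by (simp add: drift_def)
  moreover from this[of 0] have "B + L + R \<ge> 0" using norm_ge_zero[of "drift 0"] by linarith
  ultimately show ?thesis using that by blast
qed

text \<open>The additive error absorbs the noise. The rate \<open>C\<close> does not depend on
  \<open>\<epsilon>\<close>, and one \<open>M\<close> serves all later pairs whatever the time
  between them.\<close>

definition asymp_lipschitz :: "real \<Rightarrow> bool" where
  "asymp_lipschitz C \<longleftrightarrow> C \<ge> 0 \<and>
     (\<forall>\<epsilon>>0. \<exists>M. \<forall>m\<ge>M. \<forall>l\<ge>m. norm (x l - x m) \<le> C * (time l - time m) + \<epsilon>)"

text \<open>Away from the lower face the coordinate of \<open>n k\<close> is nonnegative and can
  only push down; away from the upper face it can only push up.\<close>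

lemma coordinate_step:
  assumes "i \<in> Basis"
  shows "x (Suc k) \<bullet> i > a \<bullet> i \<Longrightarrow> x (Suc k) \<bullet> i \<le> x k \<bullet> i - (\<gamma> k *\<^sub>R (drift k + e k)) \<bullet> i"
    and "x (Suc k) \<bullet> i < b \<bullet> i \<Longrightarrow> x (Suc k) \<bullet> i \<ge> x k \<bullet> i - (\<gamma> k *\<^sub>R (drift k + e k)) \<bullet> i"
proof -
  have eq: "x (Suc k) \<bullet> i = x k \<bullet> i - (\<gamma> k *\<^sub>R (drift k + e k)) \<bullet> i - n k \<bullet> i"
    by (subst step) (simp add: drift_def inner_diff_left)
  have n: "n k \<bullet> i > 0 \<Longrightarrow> x (Suc k) \<bullet> i = b \<bullet> i" "n k \<bullet> i < 0 \<Longrightarrow> x (Suc k) \<bullet> i = a \<bullet> i"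
    using normal_cone_cbox[OF x_box, THEN iffD1, OF n_normal] assms by blast+
  show "x (Suc k) \<bullet> i > a \<bullet> i \<Longrightarrow> x (Suc k) \<bullet> i \<le> x k \<bullet> i - (\<gamma> k *\<^sub>R (drift k + e k)) \<bullet> i"
    using eq n(2) by linarith
  show "x (Suc k) \<bullet> i < b \<bullet> i \<Longrightarrow> x (Suc k) \<bullet> i \<ge> x k \<bullet> i - (\<gamma> k *\<^sub>R (drift k + e k)) \<bullet> i"
    using eq n(1) by linarith
qed

text \<open>The normal terms cannot be estimated one by one, because only signed sums of the noise
  are controlled. The reflection estimate, applied to each coordinate and to its negative, replaces
  them by increments of the unreflected displacement \<open>s\<close>, which drift and noise
  bound.\<close>

lemma asymp_lipschitz_exists: obtains C where "asymp_lipschitz C"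
proof -
  obtain C where C: "C \<ge> 0" "\<And>k. norm (drift k) \<le> C" using drift_bounded by blast
  define D where "D = real DIM('a)"
  have D: "D > 0" by (simp add: D_def)
  define s where "s m = (\<Sum>k<m. \<gamma> k *\<^sub>R drift k) + noise m" for m
  have s_Suc: "s (Suc k) - s k = \<gamma> k *\<^sub>R (drift k + e k)" for k
    by (simp add: s_def noise_def scaleR_add_right)
  have s_diff: "norm (s l - s j) \<le> C * (time l - time j) + norm (noise l - noise j)" if "j \<le> l" for j l
  proof -
    have "(\<Sum>k<l. \<gamma> k *\<^sub>R drift k) - (\<Sum>k<j. \<gamma> k *\<^sub>R drift k) = (\<Sum>k=j..<l. \<gamma> k *\<^sub>R drift k)"
      using sum_diff_nat_ivl[of 0 j l "\<lambda>k. \<gamma> k *\<^sub>R drift k"] that by (simp add: atLeast0LessThan)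
    then have eq: "s l - s j = (\<Sum>k=j..<l. \<gamma> k *\<^sub>R drift k) + (noise l - noise j)"
      by (simp add: s_def algebra_simps)
    have "norm (\<Sum>k=j..<l. \<gamma> k *\<^sub>R drift k) \<le> (\<Sum>k=j..<l. C * \<gamma> k)"
    proof (rule sum_norm_le)
      fix k show "norm (\<gamma> k *\<^sub>R drift k) \<le> C * \<gamma> k"
        using C(2)[of k] \<gamma>_pos[of k] by (simp add: mult.commute mult_left_mono)
    qed
    also have "\<dots> = C * (time l - time j)" using that by (simp add: time_diff sum_distrib_left)
    finally show ?thesis unfolding eq by (intro order_trans[OF norm_triangle_ineq] add_right_mono)
  qed
  have "asymp_lipschitz (D * C)"
    unfolding asymp_lipschitz_def
  proof (intro conjI allI impI)
    show "0 \<le> D * C" using D C by simp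
    fix \<epsilon> :: real assume "\<epsilon> > 0"
    \<comment> \<open>The norm is bounded by the sum of \<open>D\<close> coordinates, so each may
      err by \<open>\<epsilon> / D\<close>; the same sum turns the rate \<open>C\<close> into
      \<open>D * C\<close>.\<close>
    then have "\<epsilon> / D > 0" using D by simp
    then obtain M where M: "\<And>m l. m \<ge> M \<Longrightarrow> l \<ge> M \<Longrightarrow> norm (noise l - noise m) < \<epsilon> / D"
      using noise_Cauchy by blast
    show "\<exists>M. \<forall>m\<ge>M. \<forall>l\<ge>m. norm (x l - x m) \<le> D * C * (time l - time m) + \<epsilon>"
    proof (intro exI allI impI)
      fix m l assume ml: "M \<le> m" "m \<le> l"
      have bound: "norm (s l - s j) \<le> C * (time l - time m) + \<epsilon> / D" if "j \<in> {m..l}" for j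
      proof -
        have "C * (time l - time j) \<le> C * (time l - time m)"
          using that C(1) by (intro mult_left_mono diff_left_mono time_mono) auto
        moreover have "norm (noise l - noise j) \<le> \<epsilon> / D" using M[of j l] that ml by simp
        ultimately show ?thesis using s_diff[of j l] that by simp
      qed
      have coord: "\<bar>(x l - x m) \<bullet> i\<bar> \<le> C * (time l - time m) + \<epsilon> / D" if i: "i \<in> Basis" for i
      proof -
        have box: "a \<bullet> i \<le> x k \<bullet> i" "x k \<bullet> i \<le> b \<bullet> i" for k using x_box[of k] i by (auto simp: mem_box)
        have "\<exists>j\<in>{m..l}. x l \<bullet> i - x m \<bullet> i \<le> s j \<bullet> i - s l \<bullet> i"
        proof (rule one_sided_reflection_bound[OF ml(2), of "a \<bullet> i" "\<lambda>k. x k \<bullet> i"])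
          show "x (Suc k) \<bullet> i \<le> x k \<bullet> i - (s (Suc k) \<bullet> i - s k \<bullet> i)" if "a \<bullet> i < x (Suc k) \<bullet> i" for k
            using coordinate_step(1)[OF i that] by (simp only: inner_diff_left[symmetric] s_Suc)
        qed (rule box)
        then obtain j where j: "j \<in> {m..l}" "x l \<bullet> i - x m \<bullet> i \<le> (s j - s l) \<bullet> i"
          by (auto simp: inner_diff_left)
        \<comment> \<open>Negation turns the upper face into a lower barrier.\<close>
        have "\<exists>j\<in>{m..l}. - (x l \<bullet> i) - - (x m \<bullet> i) \<le> - (s j \<bullet> i) - - (s l \<bullet> i)"
        proof (rule one_sided_reflection_bound[OF ml(2), of "- (b \<bullet> i)" "\<lambda>k. - (x k \<bullet> i)" "\<lambda>k. - (s k \<bullet> i)"])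
          fix k assume "- (b \<bullet> i) < - (x (Suc k) \<bullet> i)"
          then have "x (Suc k) \<bullet> i \<ge> x k \<bullet> i - (s (Suc k) - s k) \<bullet> i"
            using coordinate_step(2)[OF i, of k] by (simp add: s_Suc)
          then show "- (x (Suc k) \<bullet> i) \<le> - (x k \<bullet> i) - (- (s (Suc k) \<bullet> i) - - (s k \<bullet> i))"
            by (simp add: inner_diff_left)
        qed (use box in simp)
        then obtain j' where j': "j' \<in> {m..l}" "x m \<bullet> i - x l \<bullet> i \<le> (s l - s j') \<bullet> i"
          by (auto simp: inner_diff_left)
        have "(s j - s l) \<bullet> i \<le> norm (s l - s j)" "(s l - s j') \<bullet> i \<le> norm (s l - s j')"
          using Basis_le_norm[OF i, of "s j - s l"] Basis_le_norm[OF i, of "s l - s j'"]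
          by (simp_all add: norm_minus_commute)
        then show ?thesis using j j' bound[OF j(1)] bound[OF j'(1)] by (simp add: inner_diff_left)
      qed
      have "norm (x l - x m) \<le> (\<Sum>i\<in>Basis. \<bar>(x l - x m) \<bullet> i\<bar>)" by (rule norm_le_l1)
      also have "\<dots> \<le> (\<Sum>i\<in>(Basis::'a set). C * (time l - time m) + \<epsilon> / D)" by (rule sum_mono[OF coord])
      also have "\<dots> = D * C * (time l - time m) + \<epsilon>"
        using D unfolding sum_constant D_def[symmetric] by (simp add: algebra_simps)
      finally show "norm (x l - x m) \<le> D * C * (time l - time m) + \<epsilon>" .
    qed
  qed
  then show ?thesis using that by blast
qed

lemma successive_diff_tendsto: "(\<lambda>k. x (Suc k) - x k) \<longlonglongrightarrow> 0"
proof (rule LIMSEQ_I)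
  fix \<epsilon> :: real assume \<epsilon>: "\<epsilon> > 0"
  obtain C where C: "asymp_lipschitz C" using asymp_lipschitz_exists by blast
  obtain M where M: "\<And>m l. m \<ge> M \<Longrightarrow> l \<ge> m \<Longrightarrow> norm (x l - x m) \<le> C * (time l - time m) + \<epsilon> / 2"
    using C \<epsilon> unfolding asymp_lipschitz_def by (meson half_gt_zero)
  have "(\<lambda>k. C * \<gamma> k) \<longlonglongrightarrow> C * 0" by (intro tendsto_intros \<gamma>_lim)
  then have "\<forall>\<^sub>F k in sequentially. C * \<gamma> k < \<epsilon> / 2" using \<epsilon> by (intro order_tendstoD) auto
  then obtain M' where M': "\<And>k. k \<ge> M' \<Longrightarrow> C * \<gamma> k < \<epsilon> / 2" unfolding eventually_sequentially by blast
  have "norm (x (Suc k) - x k - 0) < \<epsilon>" if "k \<ge> max M M'" for k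
    using M[of k "Suc k"] M'[of k] that by (simp add: time_Suc)
  then show "\<exists>N. \<forall>k\<ge>N. norm (x (Suc k) - x k - 0) < \<epsilon>" by blast
qed

text \<open>The map \<open>s \<mapsto> x (idx m s)\<close> is the path restarted at \<open>m\<close>
  and read in the time scale of the step sizes: a step function in place of an interpolated
  curve.\<close>

definition idx :: "nat \<Rightarrow> real \<Rightarrow> nat" where
  "idx m s = (LEAST j. m \<le> j \<and> s \<le> time j - time m)"

lemma idx_exists: "\<exists>j. m \<le> j \<and> s \<le> time j - time m"
proof -
  have "\<forall>\<^sub>F j in sequentially. s + time m \<le> time j"
    using \<gamma>_sum unfolding time_def[abs_def] filterlim_at_top by blast
  moreover have "\<forall>\<^sub>F j in sequentially. m \<le> j" by (rule eventually_ge_at_top)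
  ultimately have "\<forall>\<^sub>F j in sequentially. m \<le> j \<and> s \<le> time j - time m"
    by eventually_elim simp
  then show ?thesis using eventually_happens' sequentially_bot by blast
qed

lemma idx_ge: "m \<le> idx m s" and idx_time: "s \<le> time (idx m s) - time m"
proof -
  have "m \<le> idx m s \<and> s \<le> time (idx m s) - time m"
    unfolding idx_def by (rule LeastI_ex[OF idx_exists])
  then show "m \<le> idx m s" "s \<le> time (idx m s) - time m" by blast+
qed

lemma idx_le:
  assumes "m \<le> j" "s \<le> time j - time m"
  shows "idx m s \<le> j"
  unfolding idx_def using assms by (intro Least_le conjI)

lemma idx_0: "idx m 0 = m"
  using idx_le[of m m 0] idx_ge[of m 0] by (intro antisym) simp_all

lemma idx_mono:
  assumes "s \<le> s'"
  shows "idx m s \<le> idx m s'"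
  by (rule idx_le[OF idx_ge order_trans[OF assms idx_time]])

text \<open>The overshoot beyond \<open>s\<close> is at most the last step size taken, which is
  small once \<open>m\<close> is large.\<close>

lemma idx_time_le:
  assumes "\<epsilon> > 0"
  obtains M where "\<And>m s. m \<ge> M \<Longrightarrow> s \<ge> 0 \<Longrightarrow> time (idx m s) - time m \<le> s + \<epsilon>"
proof -
  have "\<forall>\<^sub>F k in sequentially. \<gamma> k < \<epsilon>" using \<gamma>_lim assms by (rule order_tendstoD)
  then obtain M where M: "\<And>k. k \<ge> M \<Longrightarrow> \<gamma> k < \<epsilon>" unfolding eventually_sequentially by blast
  have "time (idx m s) - time m \<le> s + \<epsilon>" if ms: "m \<ge> M" "s \<ge> 0" for m s
  proof (cases "idx m s = m")
    case True
    then show ?thesis using ms assms by simp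
  next
    case False
    then obtain k where k: "idx m s = Suc k" "m \<le> k"
      using idx_ge[of m s] by (cases "idx m s") auto
    then have "\<not> s \<le> time k - time m" using idx_le[of m k s] by auto
    then show ?thesis using M[of k] ms k by (simp add: time_Suc)
  qed
  then show ?thesis using that by blast
qed

lemma sample_equicontinuous:
  assumes C: "asymp_lipschitz C" and \<epsilon>: "\<epsilon> > 0"
  obtains M where "\<And>m s s'. m \<ge> M \<Longrightarrow> 0 \<le> s \<Longrightarrow> s \<le> s' \<Longrightarrow>
    norm (x (idx m s') - x (idx m s)) \<le> C * (s' - s) + \<epsilon>"
proof -
  have C0: "C \<ge> 0" using C by (simp add: asymp_lipschitz_def)
  have "\<epsilon> / 2 / (C + 1) > 0" using \<epsilon> C0 by simp
  then obtain M1 where M1: "\<And>m s. m \<ge> M1 \<Longrightarrow> s \<ge> 0 \<Longrightarrow> time (idx m s) - time m \<le> s + \<epsilon> / 2 / (C + 1)"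
    using idx_time_le by blast
  obtain M2 where M2: "\<And>m l. m \<ge> M2 \<Longrightarrow> l \<ge> m \<Longrightarrow> norm (x l - x m) \<le> C * (time l - time m) + \<epsilon> / 2"
    using C \<epsilon> unfolding asymp_lipschitz_def by (meson half_gt_zero)
  show ?thesis
  proof
    fix m s s' assume ms: "m \<ge> max M1 M2" "0 \<le> s" "s \<le> (s'::real)"
    have "time (idx m s') - time (idx m s) \<le> s' - s + \<epsilon> / 2 / (C + 1)"
      using M1[of m s'] ms idx_time[of s m] by simp
    then have "C * (time (idx m s') - time (idx m s)) \<le> C * (s' - s + \<epsilon> / 2 / (C + 1))"
      using C0 by (rule mult_left_mono)
    also have "\<dots> \<le> C * (s' - s) + \<epsilon> / 2"
      using C0 \<epsilon> by (simp add: distrib_left divide_le_eq pos_divide_le_eq mult_left_mono)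
    finally have "C * (time (idx m s') - time (idx m s)) \<le> C * (s' - s) + \<epsilon> / 2" .
    moreover have "norm (x (idx m s') - x (idx m s)) \<le> C * (time (idx m s') - time (idx m s)) + \<epsilon> / 2"
      using ms idx_ge[of m s] by (intro M2 idx_mono) auto
    ultimately show "norm (x (idx m s') - x (idx m s)) \<le> C * (s' - s) + \<epsilon>" by simp
  qed
qed

definition limit_curve :: "(nat \<Rightarrow> nat) \<Rightarrow> (real \<Rightarrow> 'a) \<Rightarrow> bool" where
  "limit_curve \<phi> z \<longleftrightarrow> strict_mono \<phi> \<and> (\<forall>s\<ge>0. (\<lambda>j. x (idx (\<phi> j) s)) \<longlonglongrightarrow> z s)"

text \<open>An Arzela-Ascoli argument for step functions: a diagonal subsequence converges at all
  nonnegative rational times, and the asymptotic Lipschitz bound, whose error vanishes along the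
  subsequence, extends convergence to every time.\<close>

lemma limit_curve_exists:
  assumes C: "asymp_lipschitz C" and \<phi>: "strict_mono (\<phi> :: nat \<Rightarrow> nat)"
  obtains \<psi> z where "strict_mono \<psi>" "limit_curve (\<phi> \<circ> \<psi>) z"
proof -
  have C0: "C \<ge> 0" using C by (simp add: asymp_lipschitz_def)
  obtain B where B: "\<And>k. norm (x k) \<le> B"
    using x_box bounded_cbox[of a b] unfolding bounded_iff by blast
  define R where "R = {q \<in> \<rat>. q \<ge> (0::real)}"
  have "countable R" unfolding R_def using countable_rat by (rule countable_subset[rotated]) auto
  then obtain \<psi> where \<psi>: "strict_mono \<psi>" "\<And>q. q \<in> R \<Longrightarrow> \<exists>l. (\<lambda>j. x (idx (\<phi> (\<psi> j)) q)) \<longlonglongrightarrow> l"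
    using function_convergent_subsequence[of R "\<lambda>j q. x (idx (\<phi> j) q)" B] B by blast
  have "convergent (\<lambda>j. x (idx (\<phi> (\<psi> j)) s))" if s: "s \<ge> 0" for s
  proof -
    have "Cauchy (\<lambda>j. x (idx (\<phi> (\<psi> j)) s))"
    proof (rule metric_CauchyI)
      fix \<epsilon> :: real assume \<epsilon>: "\<epsilon> > 0"
      have "s < s + \<epsilon> / 8 / (C + 1)" using \<epsilon> C0 by simp
      then obtain q where q: "q \<in> \<rat>" "s < q" "q < s + \<epsilon> / 8 / (C + 1)"
        using Rats_dense_in_real by blast
      have "C + 1 > 0" "q - s < \<epsilon> / 8 / (C + 1)" using C0 q by linarith+
      then have "(q - s) * (C + 1) < \<epsilon> / 8" by (simp only: pos_less_divide_eq)
      then have Cq: "C * (q - s) < \<epsilon> / 8" using q by (simp add: algebra_simps)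
      have "\<epsilon> / 8 > 0" using \<epsilon> by simp
      then obtain M where M: "\<And>m s s'. m \<ge> M \<Longrightarrow> 0 \<le> s \<Longrightarrow> s \<le> s' \<Longrightarrow>
          norm (x (idx m s') - x (idx m s)) \<le> C * (s' - s) + \<epsilon> / 8"
        using sample_equicontinuous[OF C] by metis
      have "Cauchy (\<lambda>j. x (idx (\<phi> (\<psi> j)) q))"
        using \<psi>(2)[of q] q s LIMSEQ_imp_Cauchy by (auto simp: R_def)
      then obtain M' where M': "\<And>i j. i \<ge> M' \<Longrightarrow> j \<ge> M' \<Longrightarrow>
          dist (x (idx (\<phi> (\<psi> i)) q)) (x (idx (\<phi> (\<psi> j)) q)) < \<epsilon> / 2"
        using \<epsilon> unfolding Cauchy_def by (meson half_gt_zero)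
      have close: "dist (x (idx (\<phi> (\<psi> j)) q)) (x (idx (\<phi> (\<psi> j)) s)) < \<epsilon> / 4" if "j \<ge> M" for j
      proof -
        have "\<phi> (\<psi> j) \<ge> M"
          using seq_suble[OF \<psi>(1), of j] seq_suble[OF \<phi>, of "\<psi> j"] that by linarith
        from M[OF this s, of q] q Cq show ?thesis by (simp add: dist_norm)
      qed
      show "\<exists>M. \<forall>i\<ge>M. \<forall>j\<ge>M. dist (x (idx (\<phi> (\<psi> i)) s)) (x (idx (\<phi> (\<psi> j)) s)) < \<epsilon>"
      proof (intro exI allI impI)
        fix i j assume ij: "i \<ge> max M M'" "j \<ge> max M M'"
        have "dist (x (idx (\<phi> (\<psi> i)) s)) (x (idx (\<phi> (\<psi> j)) s))
          \<le> dist (x (idx (\<phi> (\<psi> i)) s)) (x (idx (\<phi> (\<psi> i)) q))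
            + dist (x (idx (\<phi> (\<psi> i)) q)) (x (idx (\<phi> (\<psi> j)) q))
            + dist (x (idx (\<phi> (\<psi> j)) q)) (x (idx (\<phi> (\<psi> j)) s))"
          using dist_triangle[of "x (idx (\<phi> (\<psi> i)) s)" "x (idx (\<phi> (\<psi> j)) s)" "x (idx (\<phi> (\<psi> i)) q)"]
            dist_triangle[of "x (idx (\<phi> (\<psi> i)) q)" "x (idx (\<phi> (\<psi> j)) s)" "x (idx (\<phi> (\<psi> j)) q)"]
          by linarith
        then show "dist (x (idx (\<phi> (\<psi> i)) s)) (x (idx (\<phi> (\<psi> j)) s)) < \<epsilon>"
          using close[of i] close[of j] M'[of i j] ij by (simp add: dist_commute)
      qed
    qed
    then show ?thesis by (rule Cauchy_convergent)
  qed
  then have "limit_curve (\<phi> \<circ> \<psi>) (\<lambda>s. lim (\<lambda>j. x (idx (\<phi> (\<psi> j)) s)))"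
    using strict_mono_o[OF \<phi> \<psi>(1)] by (simp add: limit_curve_def convergent_LIMSEQ_iff)
  then show ?thesis by (rule that[OF \<psi>(1)])
qed

end

subsection \<open>Descent along limit curves\<close>

lemma GDERIV_bound:
  assumes "GDERIV f z :> D" "\<epsilon> > 0"
  obtains d where "d > 0" "\<And>w. norm w < d \<Longrightarrow> \<bar>f (z + w) - f z - D \<bullet> w\<bar> \<le> \<epsilon> * norm w"
proof -
  obtain d where d: "d > 0" "\<And>y. norm (y - z) < d \<Longrightarrow> norm (f y - f z - (y - z) \<bullet> D) \<le> \<epsilon> * norm (y - z)"
    using assms unfolding gderiv_def has_derivative_at_alt by blast
  show ?thesis
  proof (rule that[OF d(1)])
    show "\<bar>f (z + w) - f z - D \<bullet> w\<bar> \<le> \<epsilon> * norm w" if "norm w < d" for w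
      using d(2)[of "z + w"] that by (simp add: inner_commute)
  qed
qed

context proximal_path
begin

text \<open>With the weights \<open>\<gamma> k / \<tau>\<close>, the nearby gradients at
  \<open>w\<close> average to one element of the convex Clarke gradient, while the normals simply
  add up inside the cone. The three approximations, of \<open>gradf\<close>, of \<open>v\<close> and
  of \<open>r\<close> by 0, cost \<open>\<epsilon>\<close> each per unit of time.\<close>

lemma window_average:
  assumes "p < q"
    and close: "\<And>k. p \<le> k \<Longrightarrow> k < q \<Longrightarrow> norm (gradf (x k) - gradf w) \<le> \<epsilon>"
      "\<And>k. p \<le> k \<Longrightarrow> k < q \<Longrightarrow> \<exists>\<zeta>\<in>clarke_gradient g w. norm (v k - \<zeta>) \<le> \<epsilon>"
      "\<And>k. p \<le> k \<Longrightarrow> k < q \<Longrightarrow> norm (r k) \<le> \<epsilon>"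
      "\<And>k. p \<le> k \<Longrightarrow> k < q \<Longrightarrow> n k \<in> normal_cone (cbox a b) w"
  obtains \<xi> \<nu> where "\<xi> \<in> clarke_gradient g w" "\<nu> \<in> normal_cone (cbox a b) w"
    "norm (x p - x q - (time q - time p) *\<^sub>R (gradf w + \<xi>) - \<nu>)
       \<le> 3 * \<epsilon> * (time q - time p) + norm (noise q - noise p)"
proof -
  define \<tau> where "\<tau> = time q - time p"
  have \<tau>: "\<tau> = (\<Sum>k=p..<q. \<gamma> k)" unfolding \<tau>_def using assms(1) by (intro time_diff) simp
  have \<tau>_pos: "\<tau> > 0" unfolding \<tau> using assms(1) \<gamma>_pos by (intro sum_pos) auto
  obtain \<zeta> where \<zeta>: "\<And>k. p \<le> k \<Longrightarrow> k < q \<Longrightarrow> \<zeta> k \<in> clarke_gradient g w"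
    "\<And>k. p \<le> k \<Longrightarrow> k < q \<Longrightarrow> norm (v k - \<zeta> k) \<le> \<epsilon>"
    using close(2) by metis
  define \<xi> where "\<xi> = (\<Sum>k=p..<q. (\<gamma> k / \<tau>) *\<^sub>R \<zeta> k)"
  have "\<xi> \<in> clarke_gradient g w" unfolding \<xi>_def
  proof (rule convex_sum[OF _ convex_clarke_gradient])
    show "(\<Sum>k=p..<q. \<gamma> k / \<tau>) = 1"
      unfolding sum_divide_distrib[symmetric] \<tau>[symmetric] using \<tau>_pos by simp
    show "0 \<le> \<gamma> k / \<tau>" for k using \<gamma>_pos[of k] \<tau>_pos by simp
  qed (use \<zeta>(1) in auto)
  moreover have "(\<Sum>k=p..<q. n k) \<in> normal_cone (cbox a b) w"
    using close(4) by (intro sum_normal_cone) auto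
  moreover have "norm (x p - x q - \<tau> *\<^sub>R (gradf w + \<xi>) - (\<Sum>k=p..<q. n k))
       \<le> 3 * \<epsilon> * \<tau> + norm (noise q - noise p)"
  proof -
    have "\<tau> *\<^sub>R \<xi> = (\<Sum>k=p..<q. \<gamma> k *\<^sub>R \<zeta> k)"
      unfolding \<xi>_def scaleR_sum_right using \<tau>_pos by (intro sum.cong) auto
    then have "\<tau> *\<^sub>R (gradf w + \<xi>) = (\<Sum>k=p..<q. \<gamma> k *\<^sub>R (gradf w + \<zeta> k))"
      by (simp add: scaleR_add_right sum.distrib \<tau> scaleR_sum_left)
    then have eq: "x p - x q - \<tau> *\<^sub>R (gradf w + \<xi>) - (\<Sum>k=p..<q. n k)
      = (\<Sum>k=p..<q. \<gamma> k *\<^sub>R (drift k - (gradf w + \<zeta> k))) + (noise q - noise p)"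
      using increment[of p q] assms(1) by (simp add: scaleR_diff_right sum_subtractf)
    have "norm (\<Sum>k=p..<q. \<gamma> k *\<^sub>R (drift k - (gradf w + \<zeta> k))) \<le> (\<Sum>k=p..<q. \<gamma> k * (3 * \<epsilon>))"
    proof (rule sum_norm_le)
      fix k assume "k \<in> {p..<q}"
      then have k: "p \<le> k" "k < q" by auto
      have eq: "drift k - (gradf w + \<zeta> k) = (gradf (x k) - gradf w) + (v k - \<zeta> k) + r k"
        by (simp add: drift_def)
      have "norm (drift k - (gradf w + \<zeta> k)) \<le> 3 * \<epsilon>"
        unfolding eq using norm_triangle_ineq[of "(gradf (x k) - gradf w) + (v k - \<zeta> k)" "r k"]
          norm_triangle_ineq[of "gradf (x k) - gradf w" "v k - \<zeta> k"] close(1,3)[OF k] \<zeta>(2)[OF k]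
        by linarith
      then show "norm (\<gamma> k *\<^sub>R (drift k - (gradf w + \<zeta> k))) \<le> \<gamma> k * (3 * \<epsilon>)"
        using \<gamma>_pos[of k] by (simp add: mult_left_mono)
    qed
    also have "\<dots> = 3 * \<epsilon> * \<tau>"
      by (simp only: sum_distrib_right[symmetric] \<tau>[symmetric] mult.commute)
    finally show ?thesis
      unfolding eq by (intro order_trans[OF norm_triangle_ineq] add_right_mono)
  qed
  ultimately show ?thesis using that unfolding \<tau>_def by blast
qed

lemma limit_curve_box:
  assumes "limit_curve \<phi> z" "s \<ge> 0"
  shows "z s \<in> cbox a b"
proof (rule Lim_in_closed_set)
  show "(\<lambda>j. x (idx (\<phi> j) s)) \<longlonglongrightarrow> z s" using assms unfolding limit_curve_def by blast
qed (auto simp: x_box)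

lemma eventually_subseq_ge:
  assumes "strict_mono (\<phi> :: nat \<Rightarrow> nat)"
  shows "\<forall>\<^sub>F j in sequentially. \<phi> j \<ge> M"
  using filterlim_subseq[OF assms] unfolding filterlim_at_top by blast

lemma limit_curve_lipschitz:
  assumes z: "limit_curve \<phi> z" and C: "asymp_lipschitz C" and s: "0 \<le> s" "s \<le> s'"
  shows "norm (z s' - z s) \<le> C * (s' - s)"
proof (rule field_le_epsilon)
  fix \<epsilon> :: real assume "\<epsilon> > 0"
  then obtain M where M: "\<And>m s s'. m \<ge> M \<Longrightarrow> 0 \<le> s \<Longrightarrow> s \<le> s' \<Longrightarrow>
      norm (x (idx m s') - x (idx m s)) \<le> C * (s' - s) + \<epsilon>"
    using sample_equicontinuous[OF C] by metis
  have "\<forall>\<^sub>F j in sequentially. \<phi> j \<ge> M"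
    using z unfolding limit_curve_def by (blast intro: eventually_subseq_ge)
  then have ev: "\<forall>\<^sub>F j in sequentially. norm (x (idx (\<phi> j) s') - x (idx (\<phi> j) s)) \<le> C * (s' - s) + \<epsilon>"
    by eventually_elim (rule M[OF _ s])
  have "(\<lambda>j. norm (x (idx (\<phi> j) s') - x (idx (\<phi> j) s))) \<longlonglongrightarrow> norm (z s' - z s)"
    using z s unfolding limit_curve_def by (intro tendsto_intros) auto
  then show "norm (z s' - z s) \<le> C * (s' - s) + \<epsilon>"
    by (rule tendsto_upperbound[OF _ ev sequentially_bot])
qed

text \<open>A one-sided form of the differential inclusion for the limit curve; \<open>\<xi>\<close>
  and \<open>\<nu>\<close> may vary with \<open>h\<close>, but \<open>d\<close> does not. For large
  \<open>j\<close> all iterates sampled between \<open>s - h\<close> and \<open>s\<close> lie near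
  \<open>z s\<close>, so \<open>window_average\<close> applies with its base point at
  \<open>z s\<close>.\<close>

lemma limit_curve_left_expansion:
  assumes z: "limit_curve \<phi> z" and C: "asymp_lipschitz C" and s: "s > 0" and \<epsilon>: "\<epsilon> > 0"
  obtains d where "d > 0" "\<And>h. 0 < h \<Longrightarrow> h < d \<Longrightarrow> h \<le> s \<Longrightarrow>
    \<exists>\<xi>\<in>clarke_gradient g (z s). \<exists>\<nu>\<in>normal_cone (cbox a b) (z s).
      norm (z (s - h) - z s - h *\<^sub>R (gradf (z s) + \<xi> + \<nu>)) \<le> \<epsilon> * h"
proof -
  have \<phi>: "strict_mono \<phi>" and lim: "\<And>s. s \<ge> 0 \<Longrightarrow> (\<lambda>j. x (idx (\<phi> j) s)) \<longlonglongrightarrow> z s"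
    using z unfolding limit_curve_def by blast+
  have C0: "C \<ge> 0" using C by (simp add: asymp_lipschitz_def)
  define w where "w = z s"
  have w: "w \<in> cbox a b" "w \<in> X" using limit_curve_box[OF z] s box_X by (auto simp: w_def)
  define \<epsilon>1 where "\<epsilon>1 = \<epsilon> / 9"
  have \<epsilon>1: "\<epsilon>1 > 0" using \<epsilon> by (simp add: \<epsilon>1_def)
  obtain d1 where d1: "d1 > 0" "\<And>u \<xi>. dist u w < d1 \<Longrightarrow> \<xi> \<in> clarke_gradient g u \<Longrightarrow>
      \<exists>\<zeta>\<in>clarke_gradient g w. norm (\<xi> - \<zeta>) \<le> \<epsilon>1"
    using clarke_gradient_upper_semicontinuous[OF g_lip open_X w(2) \<epsilon>1] by metis
  obtain d2 where d2: "d2 > 0"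
    "\<And>u. u \<in> cbox a b \<Longrightarrow> dist u w < d2 \<Longrightarrow> normal_cone (cbox a b) u \<subseteq> normal_cone (cbox a b) w"
    using normal_cone_cbox_nearby[OF w(1)] by metis
  obtain d3 where d3: "d3 > 0" "\<And>u. u \<in> X \<Longrightarrow> dist u w < d3 \<Longrightarrow> dist (gradf u) (gradf w) < \<epsilon>1"
    using f_C1 w(2) \<epsilon>1 unfolding continuous_on_iff by metis
  define \<delta> where "\<delta> = min d1 (min d2 d3)"
  have \<delta>: "\<delta> > 0" using d1 d2 d3 by (simp add: \<delta>_def)
  have "compact ((\<lambda>\<xi>. gradf w + \<xi>) ` clarke_gradient g w)"
    by (intro compact_continuous_image continuous_intros compact_clarke_gradient[OF g_lip open_X w(2)])
  from compact_imp_bounded[OF this] obtain B0 where B0: "\<And>\<xi>. \<xi> \<in> clarke_gradient g w \<Longrightarrow> norm (gradf w + \<xi>) \<le> B0"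
    unfolding bounded_iff by auto
  define B where "B = \<bar>B0\<bar>"
  have B: "B \<ge> 0" "\<And>\<xi>. \<xi> \<in> clarke_gradient g w \<Longrightarrow> norm (gradf w + \<xi>) \<le> B"
    using order_trans[OF B0 abs_ge_self] by (simp_all add: B_def)
  obtain M1 where M1: "\<And>k. k \<ge> M1 \<Longrightarrow> dist (y k) (x (Suc k)) < \<delta> / 2"
    using LIMSEQ_D[OF y_near, of "\<delta> / 2"] \<delta> by (auto simp: dist_norm)
  obtain M2 where M2: "\<And>k. k \<ge> M2 \<Longrightarrow> norm (r k) < \<epsilon>1"
    using LIMSEQ_D[OF r_lim \<epsilon>1] by auto
  \<comment> \<open>Over a time shorter than \<open>d\<close> the curve moves by less than
    \<open>\<delta> / 8\<close>.\<close>
  define d where "d = \<delta> / 8 / (C + 1)"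
  have "d > 0" using \<delta> C0 by (simp add: d_def)
  moreover have "\<exists>\<xi>\<in>clarke_gradient g (z s). \<exists>\<nu>\<in>normal_cone (cbox a b) (z s).
      norm (z (s - h) - z s - h *\<^sub>R (gradf (z s) + \<xi> + \<nu>)) \<le> \<epsilon> * h"
    if h: "0 < h" "h < d" "h \<le> s" for h
  proof -
    \<comment> \<open>One tolerance, chosen after \<open>h\<close>, for overshoot, sampling error
      and noise. Its three bounds keep the window length positive, the iterates within
      \<open>\<delta> / 2\<close> of \<open>w\<close>, and the accumulated extra error below
      \<open>\<epsilon> * h / 2\<close>.\<close>
    define \<eta> where "\<eta> = min (h / 2) (min (\<delta> / 8 / (C + 2)) (\<epsilon> * h / 2 / (B + 3)))"
    have "\<delta> / 8 / (C + 2) > 0" "\<epsilon> * h / 2 / (B + 3) > 0" using \<delta> C0 B(1) \<epsilon> h by simp_all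
    then have \<eta>: "\<eta> > 0" "\<eta> \<le> h / 2" "\<eta> \<le> \<delta> / 8 / (C + 2)" "\<eta> \<le> \<epsilon> * h / 2 / (B + 3)"
      using h unfolding \<eta>_def by linarith+
    have "C + 1 > 0" "C + 2 > 0" "B + 3 > 0" using C0 B(1) by simp_all
    then have C\<eta>: "\<eta> * (C + 2) \<le> \<delta> / 8" and B\<eta>: "\<eta> * (B + 3) \<le> \<epsilon> * h / 2"
      and Ch: "h * (C + 1) < \<delta> / 8"
      using \<eta>(3,4) h(2) unfolding d_def by (simp_all only: pos_le_divide_eq pos_less_divide_eq)
    obtain M3 where M3: "\<And>m s. m \<ge> M3 \<Longrightarrow> s \<ge> 0 \<Longrightarrow> time (idx m s) - time m \<le> s + \<eta>"
      using idx_time_le[OF \<eta>(1)] by blast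
    obtain M4 where M4: "\<And>m l. m \<ge> M4 \<Longrightarrow> l \<ge> m \<Longrightarrow> norm (x l - x m) \<le> C * (time l - time m) + \<eta>"
      using C \<eta>(1) unfolding asymp_lipschitz_def by meson
    obtain M5 where M5: "\<And>m l. m \<ge> M5 \<Longrightarrow> l \<ge> M5 \<Longrightarrow> norm (noise l - noise m) < \<eta>"
      using noise_Cauchy[OF \<eta>(1)] by blast
    have "\<forall>\<^sub>F j in sequentially. dist (x (idx (\<phi> j) s)) w < \<eta>"
      unfolding w_def using s \<eta>(1) by (intro tendstoD lim) auto
    moreover have "\<forall>\<^sub>F j in sequentially. dist (x (idx (\<phi> j) (s - h))) (z (s - h)) < \<eta>"
      using h \<eta>(1) by (intro tendstoD lim) auto
    moreover have "\<forall>\<^sub>F j in sequentially. \<phi> j \<ge> M1 + M2 + M3 + M4 + M5"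
      by (rule eventually_subseq_ge[OF \<phi>])
    ultimately have "\<forall>\<^sub>F j in sequentially. dist (x (idx (\<phi> j) s)) w < \<eta> \<and>
       dist (x (idx (\<phi> j) (s - h))) (z (s - h)) < \<eta> \<and> \<phi> j \<ge> M1 + M2 + M3 + M4 + M5"
      by eventually_elim blast
    then obtain j where j: "dist (x (idx (\<phi> j) s)) w < \<eta>"
      "dist (x (idx (\<phi> j) (s - h))) (z (s - h)) < \<eta>" "\<phi> j \<ge> M1 + M2 + M3 + M4 + M5"
      using eventually_happens' sequentially_bot by blast
    define m p q where "m = \<phi> j" and "p = idx m (s - h)" and "q = idx m s"
    have pq: "m \<le> p" "p \<le> q" using h by (auto simp: p_def q_def idx_ge idx_mono)
    define \<tau> where "\<tau> = time q - time p"
    have "s - h \<le> time p - time m" "time p - time m \<le> s - h + \<eta>"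
      "s \<le> time q - time m" "time q - time m \<le> s + \<eta>"
      unfolding p_def q_def using idx_time M3 j(3) h s by (auto simp: m_def)
    then have \<tau>: "h - \<eta> \<le> \<tau>" "\<tau> \<le> h + \<eta>" by (auto simp: \<tau>_def)
    then have "\<tau> > 0" using \<eta> h by linarith
    then have "p < q" using pq(2) by (cases "p = q") (auto simp: \<tau>_def)
    have near: "dist (x k) w < \<delta> / 2" if k: "p \<le> k" "k \<le> q" for k
    proof -
      have "norm (x q - x k) \<le> C * (time q - time k) + \<eta>"
        using M4[of k q] k pq j(3) by (simp add: m_def)
      also have "C * (time q - time k) \<le> C * (h + \<eta>)"
        using time_mono[OF k(1)] \<tau>(2) C0 by (intro mult_left_mono) (auto simp: \<tau>_def)
      finally have "dist (x k) (x q) \<le> C * (h + \<eta>) + \<eta>" by (simp add: dist_norm norm_minus_commute)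
      moreover have "dist (x q) w < \<eta>" using j(1) by (simp add: q_def m_def)
      ultimately have "dist (x k) w < C * (h + \<eta>) + \<eta> + \<eta>"
        using dist_triangle[of "x k" w "x q"] by linarith
      also have "\<dots> \<le> h * (C + 1) + \<eta> * (C + 2)" using h by (simp add: algebra_simps)
      finally show ?thesis using Ch C\<eta> \<delta> by linarith
    qed
    have ge: "k \<ge> M1 + M2 + M3 + M4 + M5" if "p \<le> k" for k using that pq j(3) by (simp add: m_def)
    obtain \<xi> \<nu> where \<xi>: "\<xi> \<in> clarke_gradient g w" and \<nu>: "\<nu> \<in> normal_cone (cbox a b) w"
      and bound: "norm (x p - x q - \<tau> *\<^sub>R (gradf w + \<xi>) - \<nu>) \<le> 3 * \<epsilon>1 * \<tau> + norm (noise q - noise p)"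
      unfolding \<tau>_def
    proof (rule window_average[OF \<open>p < q\<close>, of w \<epsilon>1])
      fix k assume k: "p \<le> k" "k < q"
      have "x k \<in> X" using x_box box_X by blast
      then show "norm (gradf (x k) - gradf w) \<le> \<epsilon>1"
        using d3(2)[of "x k"] near[of k] k \<delta> by (auto simp: dist_norm \<delta>_def)
      have "dist (y k) w < \<delta>"
        using dist_triangle[of "y k" w "x (Suc k)"] M1[of k] near[of "Suc k"] k ge[of k] by simp
      then show "\<exists>\<zeta>\<in>clarke_gradient g w. norm (v k - \<zeta>) \<le> \<epsilon>1"
        using d1(2)[of "y k" "v k"] v_gradient by (simp add: \<delta>_def)
      show "norm (r k) \<le> \<epsilon>1" using M2[of k] ge[of k] k by simp
      show "n k \<in> normal_cone (cbox a b) w"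
        using d2(2)[OF x_box[of "Suc k"]] near[of "Suc k"] k n_normal[of k] \<delta> by (auto simp: \<delta>_def)
    qed
    \<comment> \<open>The cone property absorbs the division by \<open>h\<close>, so no bound on the
      size of the summed normals enters.\<close>
    define \<nu>' where "\<nu>' = (1 / h) *\<^sub>R \<nu>"
    have "\<nu>' \<in> normal_cone (cbox a b) w" unfolding \<nu>'_def using h by (intro scaleR_normal_cone \<nu>) simp
    moreover have "norm (z (s - h) - w - h *\<^sub>R (gradf w + \<xi> + \<nu>')) \<le> \<epsilon> * h"
    proof -
      \<comment> \<open>Sampling errors at the two ends, the averaging error, and the mismatch
        between the window length \<open>\<tau>\<close> and \<open>h\<close>.\<close>
      define A1 A2 A3 A4 where "A1 = z (s - h) - x p" and "A2 = x q - w"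
        and "A3 = x p - x q - \<tau> *\<^sub>R (gradf w + \<xi>) - \<nu>" and "A4 = (\<tau> - h) *\<^sub>R (gradf w + \<xi>)"
      have "h *\<^sub>R \<nu>' = \<nu>" using h by (simp add: \<nu>'_def)
      then have eq: "z (s - h) - w - h *\<^sub>R (gradf w + \<xi> + \<nu>') = A1 + A2 + A3 + A4"
        unfolding A1_def A2_def A3_def A4_def by (simp add: algebra_simps)
      have "norm A1 \<le> \<eta>" "norm A2 \<le> \<eta>"
        using j(1,2) by (auto simp: A1_def A2_def p_def q_def m_def dist_norm norm_minus_commute)
      moreover have "norm A3 \<le> 3 * \<epsilon>1 * (h + \<eta>) + \<eta>"
      proof -
        have "norm (noise q - noise p) \<le> \<eta>" using M5[of p q] ge[of p] ge[of q] pq by simp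
        moreover have "3 * \<epsilon>1 * \<tau> \<le> 3 * \<epsilon>1 * (h + \<eta>)" using \<tau>(2) \<epsilon>1 by (intro mult_left_mono) auto
        ultimately show ?thesis using bound by (simp add: A3_def)
      qed
      moreover have "norm A4 \<le> \<eta> * B"
        unfolding A4_def norm_scaleR using \<tau> B \<xi> by (intro mult_mono) auto
      moreover have "norm (A1 + A2 + A3 + A4) \<le> norm A1 + norm A2 + norm A3 + norm A4"
        using norm_triangle_ineq[of "A1 + A2 + A3" A4] norm_triangle_ineq[of "A1 + A2" A3]
          norm_triangle_ineq[of A1 A2] by linarith
      ultimately have "norm (A1 + A2 + A3 + A4) \<le> 3 * \<epsilon>1 * (h + \<eta>) + \<eta> * (B + 3)"
        by (simp add: algebra_simps)
      also have "3 * \<epsilon>1 * (h + \<eta>) \<le> 3 * \<epsilon>1 * (3 / 2 * h)" using \<eta>(2) \<epsilon>1 by (intro mult_left_mono) auto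
      also have "\<dots> = \<epsilon> * h / 2" by (simp add: \<epsilon>1_def)
      finally show ?thesis using B\<eta> unfolding eq by simp
    qed
    ultimately show ?thesis using \<xi> unfolding w_def[symmetric] by blast
  qed
  ultimately show ?thesis using that by blast
qed

text \<open>Clarke regularity gives a lower bound for \<open>F = f + g\<close> when moving backwards along the curve;
  looking backwards is what makes the inequality hold at every time rather than almost every time.\<close>

lemma limit_curve_left_decrease:
  assumes z: "limit_curve \<phi> z" and C: "asymp_lipschitz C" and s: "s > 0" and \<rho>: "\<rho> > 0"
    and nonstat: "\<And>\<xi> \<nu>. \<xi> \<in> clarke_gradient g (z s) \<Longrightarrow> \<nu> \<in> normal_cone (cbox a b) (z s) \<Longrightarrow>
      norm (gradf (z s) + \<xi> + \<nu>) \<ge> \<rho>"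
  shows "\<exists>d>0. \<forall>h. 0 < h \<longrightarrow> h < d \<longrightarrow> h \<le> s \<longrightarrow>
    (f (z s) + g (z s)) + \<rho>\<^sup>2 / 2 * h \<le> f (z (s - h)) + g (z (s - h))"
proof -
  have C0: "C \<ge> 0" using C by (simp add: asymp_lipschitz_def)
  define w where "w = z s"
  have w: "w \<in> X" using limit_curve_box[OF z] s box_X by (auto simp: w_def)
  \<comment> \<open>The errors below add up to \<open>h * \<epsilon> * (3 * C + \<epsilon>)\<close>;
    this choice keeps them within half of the gain \<open>h * \<rho>\<^sup>2\<close>.\<close>
  define \<epsilon> where "\<epsilon> = min 1 (\<rho>\<^sup>2 / 2 / (3 * C + 1))"
  have "\<rho>\<^sup>2 / 2 / (3 * C + 1) > 0" using \<rho> C0 by (intro divide_pos_pos) auto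
  then have \<epsilon>: "\<epsilon> > 0" "\<epsilon> \<le> 1" "\<epsilon> \<le> \<rho>\<^sup>2 / 2 / (3 * C + 1)" unfolding \<epsilon>_def by linarith+
  have "3 * C + 1 > 0" using C0 by simp
  then have \<epsilon>C: "\<epsilon> * (3 * C + 1) \<le> \<rho>\<^sup>2 / 2" using \<epsilon>(3) by (simp only: pos_le_divide_eq)
  obtain d1 where d1: "d1 > 0" "\<And>u. norm u < d1 \<Longrightarrow> \<bar>f (w + u) - f w - gradf w \<bullet> u\<bar> \<le> \<epsilon> * norm u"
    using GDERIV_bound[OF f_grad[OF w] \<epsilon>(1)] by blast
  obtain d2 where d2: "d2 > 0" "\<And>u \<xi>. norm u < d2 \<Longrightarrow> \<xi> \<in> clarke_gradient g w \<Longrightarrow>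
      g (w + u) - g w \<ge> \<xi> \<bullet> u - \<epsilon> * norm u"
    using clarke_regular_lower_bound[OF g_lip open_X w g_regular \<epsilon>(1)] by blast
  obtain d3 where d3: "d3 > 0" "\<And>h. 0 < h \<Longrightarrow> h < d3 \<Longrightarrow> h \<le> s \<Longrightarrow>
    \<exists>\<xi>\<in>clarke_gradient g w. \<exists>\<nu>\<in>normal_cone (cbox a b) w.
      norm (z (s - h) - w - h *\<^sub>R (gradf w + \<xi> + \<nu>)) \<le> \<epsilon> * h"
    using limit_curve_left_expansion[OF z C s \<epsilon>(1)] unfolding w_def by blast
  define d where "d = min d3 (min d1 d2 / (C + 1))"
  have "min d1 d2 / (C + 1) > 0" using d1 d2 C0 by (intro divide_pos_pos) auto
  then have "d > 0" using d3 by (simp add: d_def)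
  moreover have "(f w + g w) + \<rho>\<^sup>2 / 2 * h \<le> f (z (s - h)) + g (z (s - h))"
    if h: "0 < h" "h < d" "h \<le> s" for h
  proof -
    obtain \<xi> \<nu> where \<xi>: "\<xi> \<in> clarke_gradient g w" and \<nu>: "\<nu> \<in> normal_cone (cbox a b) w"
      and err: "norm (z (s - h) - w - h *\<^sub>R (gradf w + \<xi> + \<nu>)) \<le> \<epsilon> * h"
      using d3(2)[of h] h by (auto simp: d_def)
    define D where "D = z (s - h) - w"
    define W where "W = gradf w + \<xi> + \<nu>"
    have "norm (z s - z (s - h)) \<le> C * (s - (s - h))"
      using h by (intro limit_curve_lipschitz[OF z C]) auto
    then have D: "norm D \<le> C * h" by (simp add: D_def w_def norm_minus_commute)
    have "C + 1 > 0" "h < min d1 d2 / (C + 1)" using C0 h by (auto simp: d_def)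
    then have "h * (C + 1) < min d1 d2" by (simp only: pos_less_divide_eq)
    then have D_small: "norm D < d1" "norm D < d2" using D h by (auto simp: algebra_simps)
    have zD: "z (s - h) = w + D" by (simp add: D_def)
    have W: "norm W \<ge> \<rho>" unfolding W_def w_def using nonstat \<xi> \<nu> by (simp add: w_def)
    have DW: "norm (D - h *\<^sub>R W) \<le> \<epsilon> * h" using err by (simp add: D_def W_def)
    \<comment> \<open>The earlier point of the curve also lies in the box, so subtracting the normal
      part from \<open>W \<bullet> D\<close> cannot spoil the lower bound.\<close>
    have "\<nu> \<bullet> (w - z (s - h)) \<ge> 0"
      using \<nu> limit_curve_box[OF z, of "s - h"] h unfolding normal_cone_def by auto
    then have \<nu>D: "\<nu> \<bullet> D \<le> 0" by (simp add: D_def inner_diff_right)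
    \<comment> \<open>The normal cone is unbounded; the size of \<open>W\<close> is recovered from
      the Lipschitz bound on the curve.\<close>
    have hW: "h * norm W \<le> (C + \<epsilon>) * h"
    proof -
      have "norm (h *\<^sub>R W) \<le> norm D + norm (D - h *\<^sub>R W)" by (metis norm_minus_commute norm_triangle_sub add.commute)
      then show ?thesis using D DW h by (simp add: algebra_simps)
    qed
    then have WC: "norm W \<le> C + \<epsilon>" using h by (simp add: mult.commute)
    have "W \<bullet> D = h * (W \<bullet> W) + W \<bullet> (D - h *\<^sub>R W)" by (simp add: inner_diff_right)
    moreover have "\<bar>W \<bullet> (D - h *\<^sub>R W)\<bar> \<le> (C + \<epsilon>) * (\<epsilon> * h)"
      using WC DW C0 \<epsilon> by (intro order_trans[OF Cauchy_Schwarz_ineq2] mult_mono) auto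
    moreover have "W \<bullet> W \<ge> \<rho>\<^sup>2" using W \<rho> by (simp add: dot_square_norm power_mono)
    moreover from this have "h * (W \<bullet> W) \<ge> h * \<rho>\<^sup>2" using h by (intro mult_left_mono) auto
    ultimately have WD: "W \<bullet> D \<ge> h * \<rho>\<^sup>2 - (C + \<epsilon>) * (\<epsilon> * h)" by linarith
    have eD: "\<epsilon> * norm D \<le> \<epsilon> * (C * h)" using D \<epsilon> by (intro mult_left_mono) auto
    have "(f (w + D) + g (w + D)) - (f w + g w) \<ge> gradf w \<bullet> D + \<xi> \<bullet> D - 2 * (\<epsilon> * (C * h))"
      using d1(2)[OF D_small(1)] d2(2)[OF D_small(2) \<xi>] eD by linarith
    moreover have "gradf w \<bullet> D + \<xi> \<bullet> D = W \<bullet> D - \<nu> \<bullet> D" by (simp add: W_def inner_add_left)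
    ultimately have "(f (w + D) + g (w + D)) - (f w + g w)
        \<ge> h * \<rho>\<^sup>2 - (C + \<epsilon>) * (\<epsilon> * h) - 2 * (\<epsilon> * (C * h))" using WD \<nu>D by linarith
    also have "h * \<rho>\<^sup>2 - (C + \<epsilon>) * (\<epsilon> * h) - 2 * (\<epsilon> * (C * h)) = h * (\<rho>\<^sup>2 - \<epsilon> * (3 * C + \<epsilon>))"
      by (simp add: algebra_simps)
    finally have "(f (w + D) + g (w + D)) - (f w + g w) \<ge> h * (\<rho>\<^sup>2 - \<epsilon> * (3 * C + \<epsilon>))" .
    moreover have "\<epsilon> * (3 * C + \<epsilon>) \<le> \<epsilon> * (3 * C + 1)" using \<epsilon> by (intro mult_left_mono) auto
    then have "h * (\<rho>\<^sup>2 - \<epsilon> * (3 * C + \<epsilon>)) \<ge> h * (\<rho>\<^sup>2 / 2)" using \<epsilon>C h by (intro mult_left_mono) auto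
    ultimately show ?thesis unfolding zD by (simp add: mult.commute)
  qed
  ultimately show ?thesis unfolding w_def[symmetric] by blast
qed

end

subsection \<open>Limit points are stationary\<close>

context proximal_path
begin

lemma continuous_on_objective: "continuous_on (cbox a b) (\<lambda>z. f z + g z)"
proof (intro continuous_on_add)
  have "continuous_on X f"
  proof (rule has_derivative_continuous_on)
    show "(f has_derivative (\<lambda>h. h \<bullet> gradf z)) (at z within X)" if "z \<in> X" for z
      using f_grad[OF that] unfolding gderiv_def by (rule has_derivative_at_withinI)
  qed
  then show "continuous_on (cbox a b) f" using box_X continuous_on_subset by blast
  show "continuous_on (cbox a b) g"
    unfolding continuous_on_eq_continuous_within
  proof
    fix z assume "z \<in> cbox a b"
    then obtain d L where d: "d > 0" "L-lipschitz_on (ball z d) g"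
      using locally_lipschitz_ball[OF g_lip open_X] box_X by (metis subsetD)
    have "isCont g z"
      using lipschitz_on_continuous_on[OF d(2)] d(1) by (simp add: continuous_on_eq_continuous_at)
    then show "continuous (at z within cbox a b) g" by (rule continuous_at_imp_continuous_at_within)
  qed
qed

lemma objective_tendsto:
  assumes "u \<longlonglongrightarrow> z" "\<And>k::nat. u k \<in> cbox a b" "z \<in> cbox a b"
  shows "(\<lambda>k. f (u k) + g (u k)) \<longlonglongrightarrow> f z + g z"
proof -
  have "\<forall>\<^sub>F k in sequentially. u k \<in> cbox a b" using assms(2) by (rule eventuallyI)
  from continuous_on_tendsto_compose[OF continuous_on_objective assms(1,3) this] show ?thesis .
qed

text \<open>The limit curve started at \<open>z0\<close> stays among uniformly nonstationary points
  for a time \<open>T\<close>, so the objective falls along it by a fixed amount, and continuity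
  transfers the fall to the iterates. The bound \<open>\<eta>\<close> on intermediate values later
  prevents an upcrossing from being completed before the fall.\<close>

lemma descent_near_nonstationary_limit:
  assumes \<phi>: "strict_mono \<phi>" and lim: "(\<lambda>j. x (\<phi> j)) \<longlonglongrightarrow> z0" and \<eta>: "\<eta> > 0"
    and z0: "z0 \<notin> stationary_set (cbox a b) gradf g"
  obtains \<epsilon> where "\<epsilon> > 0" "\<And>M. \<exists>j\<ge>M. \<exists>l>\<phi> j.
    f (x l) + g (x l) \<le> f (x (\<phi> j)) + g (x (\<phi> j)) - \<epsilon> \<and>
    (\<forall>k\<in>{\<phi> j..l}. f (x k) + g (x k) \<le> f (x (\<phi> j)) + g (x (\<phi> j)) + \<eta>)"
proof -
  define F where "F z = f z + g z" for z
  obtain C where C: "asymp_lipschitz C" using asymp_lipschitz_exists by blast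
  then have C0: "C \<ge> 0" by (simp add: asymp_lipschitz_def)
  have z0_box: "z0 \<in> cbox a b" by (rule Lim_in_closed_set[OF _ _ _ lim]) (auto simp: x_box)
  obtain d1 \<rho> where d1: "d1 > 0" "\<rho> > 0"
    "\<And>z \<xi> n. z \<in> cbox a b \<Longrightarrow> dist z z0 < d1 \<Longrightarrow> \<xi> \<in> clarke_gradient g z \<Longrightarrow>
       n \<in> normal_cone (cbox a b) z \<Longrightarrow> norm (gradf z + \<xi> + n) \<ge> \<rho>"
    using nonstationary_nearby[OF open_X box_X g_lip f_C1 z0_box z0] by metis
  obtain d2 where d2: "d2 > 0" "\<And>z. z \<in> cbox a b \<Longrightarrow> dist z z0 < d2 \<Longrightarrow> dist (F z) (F z0) < \<eta> / 2"
    using continuous_on_objective z0_box \<eta> unfolding continuous_on_iff F_def by (meson half_gt_zero)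
  define \<delta> where "\<delta> = min d1 d2"
  have \<delta>: "\<delta> > 0" using d1 d2 by (simp add: \<delta>_def)
  \<comment> \<open>Sampling may overshoot to time \<open>2 * T\<close>. The iterates then move by
    less than \<open>2 * (\<delta> / 4) + \<delta> / 4\<close>, and they start within
    \<open>\<delta> / 4\<close> of \<open>z0\<close>, so they stay within
    \<open>\<delta>\<close>.\<close>
  define T where "T = \<delta> / 4 / (C + 1)"
  have "C + 1 > 0" using C0 by simp
  then have T: "T > 0" "T * (C + 1) = \<delta> / 4"
    using \<delta> T_def nonzero_divide_eq_eq[of "C + 1" "\<delta> / 4" T] by (auto simp: T_def intro!: divide_pos_pos)
  then have CT: "C * T < \<delta> / 4" by (simp add: algebra_simps)
  obtain \<psi> z where \<psi>: "strict_mono \<psi>" and z: "limit_curve (\<phi> \<circ> \<psi>) z"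
    using limit_curve_exists[OF C \<phi>] by blast
  then have mono: "strict_mono (\<phi> \<circ> \<psi>)"
    and zlim: "\<And>s. s \<ge> 0 \<Longrightarrow> (\<lambda>j. x (idx (\<phi> (\<psi> j)) s)) \<longlonglongrightarrow> z s"
    by (simp_all add: limit_curve_def)
  have lim\<psi>: "(\<lambda>j. x (\<phi> (\<psi> j))) \<longlonglongrightarrow> z0" using LIMSEQ_subseq_LIMSEQ[OF lim \<psi>] by (simp add: o_def)
  have "(\<lambda>j. x (\<phi> (\<psi> j))) \<longlonglongrightarrow> z 0" using zlim[of 0] by (simp add: idx_0)
  then have z_0: "z 0 = z0" using lim\<psi> by (rule LIMSEQ_unique)
  have z_near: "dist (z s) z0 < \<delta>" if "0 \<le> s" "s \<le> T" for s
  proof -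
    have "norm (z s - z 0) \<le> C * (s - 0)" using that by (intro limit_curve_lipschitz[OF z C]) auto
    also have "\<dots> \<le> C * T" using that C0 by (simp add: mult_left_mono)
    finally show ?thesis using CT \<delta> by (simp add: z_0 dist_norm)
  qed
  define \<kappa> where "\<kappa> = \<rho>\<^sup>2 / 2"
  have \<kappa>: "\<kappa> > 0" using d1(2) by (simp add: \<kappa>_def)
  have "F (z T) + \<kappa> * T \<le> F (z 0)"
  proof (rule continuous_decrease_if_left_decrease)
    have "C-lipschitz_on {0..T} z"
    proof (rule lipschitz_on_leI)
      show "dist (z s) (z s') \<le> C * dist s s'" if "s \<in> {0..T}" "s' \<in> {0..T}" "s \<le> s'" for s s'
        using limit_curve_lipschitz[OF z C, of s s'] that by (simp add: dist_norm norm_minus_commute)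
    qed (rule C0)
    then have "continuous_on {0..T} z" by (rule lipschitz_on_continuous_on)
    moreover have "z ` {0..T} \<subseteq> cbox a b" using limit_curve_box[OF z] by auto
    ultimately show "continuous_on {0..T} (\<lambda>s. F (z s))"
      unfolding F_def using continuous_on_compose2[OF continuous_on_objective] by blast
    show "\<exists>d>0. \<forall>h. 0 < h \<longrightarrow> h < d \<longrightarrow> h \<le> s \<longrightarrow> F (z s) + \<kappa> * h \<le> F (z (s - h))"
      if s: "0 < s" "s \<le> T" for s
      unfolding F_def \<kappa>_def
    proof (rule limit_curve_left_decrease[OF z C s(1) d1(2)])
      show "norm (gradf (z s) + \<xi> + \<nu>) \<ge> \<rho>"
        if "\<xi> \<in> clarke_gradient g (z s)" "\<nu> \<in> normal_cone (cbox a b) (z s)" for \<xi> \<nu>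
        using that limit_curve_box[OF z, of s] z_near[of s] s by (intro d1(3)) (auto simp: \<delta>_def)
    qed
  qed (use T in simp)
  then have dec: "F (z T) \<le> F z0 - \<kappa> * T" by (simp add: z_0)
  \<comment> \<open>One third is spent on approximating the value at each end of the curve, and one
    third remains as the fall.\<close>
  define \<epsilon> where "\<epsilon> = \<kappa> * T / 3"
  have \<epsilon>: "\<epsilon> > 0" using \<kappa> T by (simp add: \<epsilon>_def)
  show ?thesis
  proof (rule that[OF \<epsilon>])
    fix M
    have "\<delta> / 4 > 0" using \<delta> by simp
    then obtain M1 where M1: "\<And>m l. m \<ge> M1 \<Longrightarrow> l \<ge> m \<Longrightarrow> norm (x l - x m) \<le> C * (time l - time m) + \<delta> / 4"
      using C unfolding asymp_lipschitz_def by meson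
    obtain M2 where M2: "\<And>m s. m \<ge> M2 \<Longrightarrow> s \<ge> 0 \<Longrightarrow> time (idx m s) - time m \<le> s + T"
      using idx_time_le[OF T(1)] by blast
    have "(\<lambda>j. F (x (idx (\<phi> (\<psi> j)) T))) \<longlonglongrightarrow> F (z T)"
      unfolding F_def using T limit_curve_box[OF z] by (intro objective_tendsto zlim x_box) auto
    then have "\<forall>\<^sub>F j in sequentially. F (x (idx (\<phi> (\<psi> j)) T)) < F (z T) + \<epsilon>"
      using \<epsilon> by (intro order_tendstoD) auto
    moreover have F0: "(\<lambda>j. F (x (\<phi> (\<psi> j)))) \<longlonglongrightarrow> F z0"
      unfolding F_def by (intro objective_tendsto lim\<psi> x_box z0_box)
    then have "\<forall>\<^sub>F j in sequentially. F z0 - \<epsilon> < F (x (\<phi> (\<psi> j)))"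
      using \<epsilon> by (intro order_tendstoD) auto
    moreover have "\<forall>\<^sub>F j in sequentially. F z0 - \<eta> / 2 < F (x (\<phi> (\<psi> j)))"
      using F0 \<eta> by (intro order_tendstoD) auto
    moreover have "\<forall>\<^sub>F j in sequentially. dist (x (\<phi> (\<psi> j))) z0 < \<delta> / 4"
      using lim\<psi> \<delta> by (intro tendstoD) auto
    moreover have "\<forall>\<^sub>F j in sequentially. (\<phi> \<circ> \<psi>) j \<ge> M1 + M2"
      by (rule eventually_subseq_ge[OF mono])
    moreover have "\<forall>\<^sub>F j in sequentially. \<psi> j \<ge> M" by (rule eventually_subseq_ge[OF \<psi>])
    ultimately have "\<forall>\<^sub>F j in sequentially. F (x (idx (\<phi> (\<psi> j)) T)) < F (z T) + \<epsilon> \<and>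
      F z0 - \<epsilon> < F (x (\<phi> (\<psi> j))) \<and> F z0 - \<eta> / 2 < F (x (\<phi> (\<psi> j))) \<and>
      dist (x (\<phi> (\<psi> j))) z0 < \<delta> / 4 \<and> (\<phi> \<circ> \<psi>) j \<ge> M1 + M2 \<and> \<psi> j \<ge> M"
      by eventually_elim blast
    then obtain j where j: "F (x (idx (\<phi> (\<psi> j)) T)) < F (z T) + \<epsilon>"
      "F z0 - \<epsilon> < F (x (\<phi> (\<psi> j)))" "F z0 - \<eta> / 2 < F (x (\<phi> (\<psi> j)))"
      "dist (x (\<phi> (\<psi> j))) z0 < \<delta> / 4" "\<phi> (\<psi> j) \<ge> M1 + M2" "\<psi> j \<ge> M"
      using eventually_happens' sequentially_bot by fastforce
    define m l where "m = \<phi> (\<psi> j)" and "l = idx m T"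
    have "time l - time m \<ge> T" unfolding l_def by (rule idx_time)
    then have "l > m" using idx_ge[of m T] T by (cases "l = m") (auto simp: l_def)
    moreover have "F (x l) \<le> F (x m) - \<epsilon>"
      using j(1,2) dec by (simp add: m_def l_def \<epsilon>_def)
    moreover have "F (x k) \<le> F (x m) + \<eta>" if k: "k \<in> {m..l}" for k
    proof -
      have "time k - time m \<le> T + T"
        using time_mono[of k l] M2[of m T] T k j(5) by (simp add: l_def m_def)
      then have "C * (time k - time m) \<le> C * (T + T)" using C0 by (rule mult_left_mono)
      moreover have "norm (x k - x m) \<le> C * (time k - time m) + \<delta> / 4"
        using k j(5) by (intro M1) (auto simp: m_def)
      ultimately have "dist (x k) (x m) < \<delta> * 3 / 4" using CT by (simp add: dist_norm algebra_simps)
      then have "dist (x k) z0 < \<delta>" using dist_triangle[of "x k" z0 "x m"] j(4) by (simp add: m_def)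
      then have "dist (F (x k)) (F z0) < \<eta> / 2" by (intro d2(2) x_box) (simp add: \<delta>_def)
      then show ?thesis using j(3) unfolding dist_real_def m_def by linarith
    qed
    ultimately show "\<exists>j\<ge>M. \<exists>l>\<phi> j. f (x l) + g (x l) \<le> f (x (\<phi> j)) + g (x (\<phi> j)) - \<epsilon> \<and>
      (\<forall>k\<in>{\<phi> j..l}. f (x k) + g (x k) \<le> f (x (\<phi> j)) + g (x (\<phi> j)) + \<eta>)"
      unfolding F_def m_def using j(6) by blast
  qed
qed

text \<open>A level \<open>c\<close> between \<open>c1\<close> and \<open>c2\<close> avoids the
  stationary values. The last iterates at or below \<open>c\<close> before upcrossings accumulate at
  a point of value exactly \<open>c\<close>, which is therefore nonstationary, and the descent from
  there is incompatible with the upcrossing.\<close>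

lemma no_oscillation:
  assumes S_values: "interior ((\<lambda>z. f z + g z) ` stationary_set (cbox a b) gradf g) = {}"
    and "c1 < c2"
    and low: "\<And>M. \<exists>k\<ge>M. f (x k) + g (x k) < c1"
    and high: "\<And>M. \<exists>k\<ge>M. f (x k) + g (x k) > c2"
  shows False
proof -
  define F where "F z = f z + g z" for z
  have "\<not> {c1<..<c2} \<subseteq> F ` stationary_set (cbox a b) gradf g"
  proof
    assume "{c1<..<c2} \<subseteq> F ` stationary_set (cbox a b) gradf g"
    then have "{c1<..<c2} \<subseteq> interior (F ` stationary_set (cbox a b) gradf g)"
      by (rule interior_maximal) simp
    then show False using S_values assms(2) by (simp add: F_def)
  qed
  then obtain c where "c \<in> {c1<..<c2}" and c_not: "c \<notin> F ` stationary_set (cbox a b) gradf g" by blast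
  then have c: "c1 < c" "c < c2" by auto
  define U where "U = {m. F (x m) \<le> c \<and> F (x (Suc m)) > c \<and>
     (\<exists>q>m. F (x q) > c2 \<and> (\<forall>k. m < k \<longrightarrow> k \<le> q \<longrightarrow> F (x k) > c))}"
  have "\<exists>m\<ge>M. m \<in> U" for M
  proof -
    obtain p where p: "p \<ge> M" "F (x p) < c1" using low unfolding F_def by blast
    obtain q where q: "q \<ge> p" "F (x q) > c2" using high unfolding F_def by blast
    define W where "W = {k \<in> {p..q}. F (x k) \<le> c}"
    have W: "finite W" "p \<in> W" using p q c by (auto simp: W_def)
    define m where "m = Max W"
    have "W \<noteq> {}" using W by blast
    then have m: "m \<in> W" "p \<le> m" unfolding m_def using W by (auto intro: Max_in Max_ge)
    have "m \<noteq> q" using m(1) q(2) c(2) by (auto simp: W_def)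
    then have "m < q" using m(1) by (auto simp: W_def)
    moreover have above: "F (x k) > c" if "m < k" "k \<le> q" for k
    proof (rule ccontr)
      assume "\<not> F (x k) > c"
      then have "k \<in> W" using that m(2) by (auto simp: W_def)
      then show False using Max_ge[OF W(1)] that(1) unfolding m_def by (meson not_le)
    qed
    ultimately have "m \<in> U" using m(1) q(2) by (auto simp: U_def W_def)
    then show ?thesis using m(2) p(1) by (intro exI[of _ m]) simp
  qed
  then have "infinite U" by (simp add: infinite_nat_iff_unbounded_le)
  from infinite_enumerate[OF this] obtain \<phi>0 :: "nat \<Rightarrow> nat"
    where \<phi>0: "strict_mono \<phi>0" "\<And>j. \<phi>0 j \<in> U" by blast
  have "\<And>j. x (\<phi>0 j) \<in> cbox a b" by (rule x_box)
  then obtain z0 s where z0: "z0 \<in> cbox a b" and s: "strict_mono s" "((\<lambda>j. x (\<phi>0 j)) \<circ> s) \<longlonglongrightarrow> z0"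
    using compact_cbox[of a b] unfolding compact_def by metis
  define \<phi> where "\<phi> = \<phi>0 \<circ> s"
  have \<phi>: "strict_mono \<phi>" unfolding \<phi>_def using \<phi>0(1) s(1) by (rule strict_mono_o)
  have U: "\<phi> j \<in> U" for j using \<phi>0(2) by (simp add: \<phi>_def)
  have lim: "(\<lambda>j. x (\<phi> j)) \<longlonglongrightarrow> z0" using s(2) by (simp add: \<phi>_def o_def)
  \<comment> \<open>The iterates just below and just above the level share their limit, which pins
    its value to \<open>c\<close>.\<close>
  have limS: "(\<lambda>j. x (Suc (\<phi> j))) \<longlonglongrightarrow> z0"
    using tendsto_add[OF LIMSEQ_subseq_LIMSEQ[OF successive_diff_tendsto \<phi>] lim] by (simp add: o_def)
  have "F z0 \<le> c"
  proof (rule LIMSEQ_le_const2)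
    show "(\<lambda>j. F (x (\<phi> j))) \<longlonglongrightarrow> F z0" unfolding F_def by (rule objective_tendsto[OF lim x_box z0])
    show "\<exists>N. \<forall>j\<ge>N. F (x (\<phi> j)) \<le> c" using U by (auto simp: U_def)
  qed
  moreover have "c \<le> F z0"
  proof (rule LIMSEQ_le_const)
    show "(\<lambda>j. F (x (Suc (\<phi> j)))) \<longlonglongrightarrow> F z0" unfolding F_def by (intro objective_tendsto limS x_box z0)
    show "\<exists>N. \<forall>j\<ge>N. c \<le> F (x (Suc (\<phi> j)))" using U by (auto simp: U_def intro: less_imp_le)
  qed
  ultimately have ns: "z0 \<notin> stationary_set (cbox a b) gradf g" using c_not by auto
  have "c2 - c > 0" using c(2) by simp
  from descent_near_nonstationary_limit[OF \<phi> lim this ns]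
  obtain \<epsilon> where "\<epsilon> > 0" "\<And>M. \<exists>j\<ge>M. \<exists>l>\<phi> j. F (x l) \<le> F (x (\<phi> j)) - \<epsilon> \<and>
    (\<forall>k\<in>{\<phi> j..l}. F (x k) \<le> F (x (\<phi> j)) + (c2 - c))"
    unfolding F_def by blast
  then obtain j l where jl: "\<epsilon> > 0" "\<phi> j < l" "F (x l) \<le> F (x (\<phi> j)) - \<epsilon>"
    "\<And>k. k \<in> {\<phi> j..l} \<Longrightarrow> F (x k) \<le> F (x (\<phi> j)) + (c2 - c)" by blast
  obtain q where q: "q > \<phi> j" "F (x q) > c2" "\<And>k. \<phi> j < k \<Longrightarrow> k \<le> q \<Longrightarrow> F (x k) > c"
    and Fj: "F (x (\<phi> j)) \<le> c" using U[of j] by (auto simp: U_def)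
  show False
  \<comment> \<open>If the crossing ends first, its end value is at most
    \<open>c + (c2 - c)\<close>. If the fall ends first, it ends below \<open>c\<close> at an index
    where the path should still be above \<open>c\<close>.\<close>
  proof (cases "q \<le> l")
    case True
    then show False using jl(4)[of q] q Fj by simp
  next
    case False
    then show False using q(3)[OF jl(2)] jl(1,3) Fj by simp
  qed
qed

text \<open>Near a nonstationary limit point the objective is infinitely often close to
  \<open>F z0\<close> and, after the guaranteed falls, infinitely often clearly below it. This is
  the oscillation excluded before.\<close>

lemma limit_points_stationary:
  assumes S_values: "interior ((\<lambda>z. f z + g z) ` stationary_set (cbox a b) gradf g) = {}"
    and \<phi>: "strict_mono \<phi>" and lim: "(\<lambda>j. x (\<phi> j)) \<longlonglongrightarrow> z0"
  shows "z0 \<in> stationary_set (cbox a b) gradf g"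
proof (rule ccontr)
  assume z0: "z0 \<notin> stationary_set (cbox a b) gradf g"
  define F where "F z = f z + g z" for z
  obtain \<epsilon> where \<epsilon>: "\<epsilon> > 0" "\<And>M. \<exists>j\<ge>M. \<exists>l>\<phi> j. F (x l) \<le> F (x (\<phi> j)) - \<epsilon>"
    using descent_near_nonstationary_limit[OF \<phi> lim zero_less_one z0] unfolding F_def by metis
  have "z0 \<in> cbox a b" by (rule Lim_in_closed_set[OF _ _ _ lim]) (auto simp: x_box)
  then have "(\<lambda>j. F (x (\<phi> j))) \<longlonglongrightarrow> F z0" unfolding F_def by (intro objective_tendsto lim x_box)
  then have "\<forall>\<^sub>F j in sequentially. dist (F (x (\<phi> j))) (F z0) < \<epsilon> / 3"
    using \<epsilon>(1) by (intro tendstoD) auto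
  then obtain M where M: "\<And>j. j \<ge> M \<Longrightarrow> dist (F (x (\<phi> j))) (F z0) < \<epsilon> / 3"
    unfolding eventually_sequentially by blast
  show False
  proof (rule no_oscillation[OF S_values, of "F z0 - 2 * \<epsilon> / 3" "F z0 - \<epsilon> / 3"])
    show "\<exists>k\<ge>N. f (x k) + g (x k) < F z0 - 2 * \<epsilon> / 3" for N
    proof -
      obtain j l where j: "j \<ge> M + N" "l > \<phi> j" "F (x l) \<le> F (x (\<phi> j)) - \<epsilon>"
        using \<epsilon>(2) by blast
      then have "F (x l) < F z0 - 2 * \<epsilon> / 3" using M[of j] unfolding dist_real_def by linarith
      moreover have "l \<ge> N" using seq_suble[OF \<phi>, of j] j by linarith
      ultimately show ?thesis unfolding F_def by blast
    qed
    show "\<exists>k\<ge>N. f (x k) + g (x k) > F z0 - \<epsilon> / 3" for N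
    proof -
      have "F (x (\<phi> (M + N))) > F z0 - \<epsilon> / 3" using M[of "M + N"] unfolding dist_real_def by linarith
      moreover have "\<phi> (M + N) \<ge> N" using seq_suble[OF \<phi>, of "M + N"] by linarith
      ultimately show ?thesis unfolding F_def by blast
    qed
  qed (use \<epsilon> in simp)
qed

theorem converges_to_stationary_set:
  assumes S_values: "interior ((\<lambda>z. f z + g z) ` stationary_set (cbox a b) gradf g) = {}"
  shows "converges_to_set x (stationary_set (cbox a b) gradf g)"
proof -
  let ?S = "stationary_set (cbox a b) gradf g"
  have sub: "\<exists>s z0. strict_mono (s :: nat \<Rightarrow> nat) \<and> z0 \<in> ?S \<and> (\<lambda>j. x (\<phi> (s j))) \<longlonglongrightarrow> z0"
    if \<phi>: "strict_mono \<phi>" for \<phi>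
  proof -
    have "\<And>j. x (\<phi> j) \<in> cbox a b" by (rule x_box)
    then obtain z0 s where s: "strict_mono s" "((\<lambda>j. x (\<phi> j)) \<circ> s) \<longlonglongrightarrow> z0"
      using compact_cbox[of a b] unfolding compact_def by metis
    then have lim: "(\<lambda>j. x ((\<phi> \<circ> s) j)) \<longlonglongrightarrow> z0" by (simp add: o_def)
    have "z0 \<in> ?S" by (rule limit_points_stationary[OF S_values strict_mono_o[OF \<phi> s(1)] lim])
    then show ?thesis using s(1) lim by auto
  qed
  \<comment> \<open>Applied to the whole sequence, compactness yields a limit point and hence the
    nonemptiness that \<open>converges_to_set\<close> demands.\<close>
  have "?S \<noteq> {}" using sub[of id] by (auto simp: strict_mono_def)
  moreover have "(\<lambda>k. infdist (x k) ?S) \<longlonglongrightarrow> 0"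
  proof (rule ccontr)
    assume "\<not> ?thesis"
    then obtain \<epsilon> where \<epsilon>: "\<epsilon> > 0" "\<And>M. \<exists>k\<ge>M. infdist (x k) ?S \<ge> \<epsilon>"
      unfolding LIMSEQ_iff by (auto simp: infdist_nonneg not_less)
    then have "infinite {k. infdist (x k) ?S \<ge> \<epsilon>}" by (simp add: infinite_nat_iff_unbounded_le)
    from infinite_enumerate[OF this] obtain \<phi> :: "nat \<Rightarrow> nat"
      where \<phi>: "strict_mono \<phi>" "\<And>j. infdist (x (\<phi> j)) ?S \<ge> \<epsilon>" by blast
    obtain s z0 where s: "z0 \<in> ?S" "(\<lambda>j. x (\<phi> (s j))) \<longlonglongrightarrow> z0" using sub[OF \<phi>(1)] by blast
    have "\<forall>\<^sub>F j in sequentially. dist (x (\<phi> (s j))) z0 < \<epsilon>" using s(2) \<epsilon>(1) by (rule tendstoD)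
    then obtain j where "dist (x (\<phi> (s j))) z0 < \<epsilon>" using eventually_happens' sequentially_bot by blast
    then show False using \<phi>(2)[of "s j"] infdist_le[OF s(1), of "x (\<phi> (s j))"] by linarith
  qed
  ultimately show ?thesis unfolding converges_to_set_def by blast
qed

end

subsection \<open>The two proximal iterations\<close>

text \<open>The data of one sample path. From here to the final theorem the argument is
  deterministic.\<close>

locale noisy_proximal_iteration =
  fixes a b :: "'a::euclidean_space" and X :: "'a set" and f g :: "'a \<Rightarrow> real"
    and gradf :: "'a \<Rightarrow> 'a" and \<gamma> :: "nat \<Rightarrow> real" and x h e r :: "nat \<Rightarrow> 'a"
  assumes open_X: "open X" and box_X: "cbox a b \<subseteq> X"
    and f_grad: "\<And>z. z \<in> X \<Longrightarrow> GDERIV f z :> gradf z"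
    and f_C1: "continuous_on X gradf"
    and g_lip: "locally_lipschitz_on X g"
    and g_regular: "clarke_regular_on X g"
    and \<gamma>_pos: "\<And>k. k \<ge> 1 \<Longrightarrow> \<gamma> k > 0"
    and \<gamma>_sum: "filterlim (\<lambda>n. \<Sum>k=1..n. \<gamma> k) at_top sequentially"
    and \<gamma>_lim: "\<gamma> \<longlonglongrightarrow> 0"
    and x0_box: "x 0 \<in> cbox a b"
    and \<delta>: "\<And>k. k \<ge> 1 \<Longrightarrow> h k - gradf (x (k - 1)) = e k + r k"
    and r_lim: "r \<longlonglongrightarrow> 0"
    and e_sum: "convergent (\<lambda>n. \<Sum>k=1..n. \<gamma> k *\<^sub>R e k)"
    and S_values: "interior ((\<lambda>z. f z + g z) ` stationary_set (cbox a b) gradf g) = {}"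
begin

lemma h_Suc: "h (Suc k) = gradf (x k) + r (Suc k) + e (Suc k)"
  using \<delta>[of "Suc k"] by (simp add: algebra_simps)

lemma e_sum_Suc: "convergent (\<lambda>m. \<Sum>k<m. \<gamma> (Suc k) *\<^sub>R e (Suc k))"
  using e_sum by (simp add: sum.atLeast1_atMost_eq)

text \<open>Substituting \<open>h_Suc\<close> brings the step to the form of
  \<open>proximal_path\<close>, with \<open>\<gamma>\<close>, \<open>r\<close> and \<open>e\<close>
  shifted by one index.\<close>

lemma decomposed_iteration_converges:
  assumes "\<And>k. x k \<in> cbox a b"
    and step: "\<And>k. x k - \<gamma> (Suc k) *\<^sub>R h (Suc k) = x (Suc k) + \<gamma> (Suc k) *\<^sub>R v k + n k"
    and "\<And>k. n k \<in> normal_cone (cbox a b) (x (Suc k))"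
    and "\<And>k. v k \<in> clarke_gradient g (y k)" "\<And>k. norm (v k) \<le> L"
    and "(\<lambda>k. y k - x (Suc k)) \<longlonglongrightarrow> 0"
  shows "converges_to_set x (stationary_set (cbox a b) gradf g)"
proof -
  interpret proximal_path a b X f g gradf "\<lambda>k. \<gamma> (Suc k)" x y v n "\<lambda>k. r (Suc k)" "\<lambda>k. e (Suc k)" L
  proof
    show "(\<lambda>k. \<gamma> (Suc k)) \<longlonglongrightarrow> 0" "(\<lambda>k. r (Suc k)) \<longlonglongrightarrow> 0"
      by (rule LIMSEQ_Suc[OF \<gamma>_lim], rule LIMSEQ_Suc[OF r_lim])
    show "filterlim (\<lambda>m. \<Sum>k<m. \<gamma> (Suc k)) at_top sequentially"
      using \<gamma>_sum by (simp add: sum.atLeast1_atMost_eq)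
    show "x (Suc k) = x k - \<gamma> (Suc k) *\<^sub>R (gradf (x k) + v k + r (Suc k) + e (Suc k)) - n k" for k
      using step[of k] unfolding h_Suc by (simp add: algebra_simps)
  qed (use assms open_X box_X f_grad f_C1 g_lip g_regular \<gamma>_pos e_sum_Suc in auto)
  show ?thesis by (rule converges_to_stationary_set[OF S_values])
qed

text \<open>The optimality condition gives gradients and normals at the new iterate itself, so
  \<open>y k\<close> is \<open>x (Suc k)\<close>; compactness of the box bounds the
  gradients.\<close>

theorem prox_iteration_A_converges:
  assumes iter: "prox_iteration_A X (cbox a b) g \<gamma> h x"
  shows "converges_to_set x (stationary_set (cbox a b) gradf g)"
proof -
  have "\<exists>\<xi> n. x (Suc k) \<in> cbox a b \<and> \<xi> \<in> clarke_gradient g (x (Suc k)) \<and>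
      n \<in> normal_cone (cbox a b) (x (Suc k)) \<and>
      x k - \<gamma> (Suc k) *\<^sub>R h (Suc k) = x (Suc k) + \<gamma> (Suc k) *\<^sub>R \<xi> + n" for k
  proof -
    have pos: "\<gamma> (Suc k) > 0" using \<gamma>_pos by simp
    have "x (Suc k) \<in> prox X (\<gamma> (Suc k)) (\<lambda>y. ereal (g y) + convex_indicator (cbox a b) y)
        (x k - \<gamma> (Suc k) *\<^sub>R h (Suc k))"
      using iter unfolding prox_iteration_A_def by (metis One_nat_def Suc_le_mono diff_Suc_1 le0)
    moreover have "cbox a b \<noteq> {}" using x0_box by blast
    ultimately show ?thesis
      using prox_convex_indicator_optimality[OF open_X box_X convex_box(1) _ g_lip pos] by blast
  qed
  then obtain \<xi> n where box: "\<And>k. x (Suc k) \<in> cbox a b"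
    and \<xi>: "\<And>k. \<xi> k \<in> clarke_gradient g (x (Suc k))"
    and n: "\<And>k. n k \<in> normal_cone (cbox a b) (x (Suc k))"
    and eq: "\<And>k. x k - \<gamma> (Suc k) *\<^sub>R h (Suc k) = x (Suc k) + \<gamma> (Suc k) *\<^sub>R \<xi> k + n k"
    by metis
  have x_box: "x k \<in> cbox a b" for k using x0_box box by (cases k) auto
  obtain L where L: "\<And>z \<xi>. z \<in> cbox a b \<Longrightarrow> \<xi> \<in> clarke_gradient g z \<Longrightarrow> norm \<xi> \<le> L"
    using clarke_gradient_bounded_on_compact[OF g_lip open_X box_X compact_cbox] by metis
  show ?thesis
    by (rule decomposed_iteration_converges[OF x_box eq n \<xi>, of L]) (auto intro: L[OF box \<xi>])
qed

text \<open>The gradients are taken at proximal points that may leave the box, so the global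
  Lipschitz constant bounds them. The projection residual \<open>y k - x (Suc k)\<close> plays the
  role of the normal vector and must be shown to vanish.\<close>

theorem prox_iteration_B_converges:
  assumes lip: "L-lipschitz_on X g" and iter: "prox_iteration_B X (cbox a b) g \<gamma> h x"
  shows "converges_to_set x (stationary_set (cbox a b) gradf g)"
proof -
  have "\<exists>y. y \<in> prox X (\<gamma> (Suc k)) (\<lambda>y. ereal (g y)) (x k - \<gamma> (Suc k) *\<^sub>R h (Suc k)) \<and>
      x (Suc k) = closest_point (cbox a b) y" for k
  proof -
    have "x (Suc k) \<in> closest_point (cbox a b) `
        prox X (\<gamma> (Suc k)) (\<lambda>y. ereal (g y)) (x k - \<gamma> (Suc k) *\<^sub>R h (Suc k))"
      using iter unfolding prox_iteration_B_def by (metis One_nat_def Suc_le_mono diff_Suc_1 le0)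
    then show ?thesis by blast
  qed
  then obtain y where y: "\<And>k. y k \<in> prox X (\<gamma> (Suc k)) (\<lambda>y. ereal (g y)) (x k - \<gamma> (Suc k) *\<^sub>R h (Suc k))"
    and x_Suc: "\<And>k. x (Suc k) = closest_point (cbox a b) (y k)" by metis
  have pos: "\<gamma> (Suc k) > 0" for k using \<gamma>_pos by simp
  define v where "v k = (1 / \<gamma> (Suc k)) *\<^sub>R (x k - \<gamma> (Suc k) *\<^sub>R h (Suc k) - y k)" for k
  have v: "v k \<in> clarke_gradient g (y k)" and y_X: "y k \<in> X" for k
    unfolding v_def using prox_in_clarke_gradient[OF open_X pos y] by auto
  have step: "x k - \<gamma> (Suc k) *\<^sub>R h (Suc k) = y k + \<gamma> (Suc k) *\<^sub>R v k" for k
    using pos[of k] by (simp add: v_def)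
  have v_bound: "norm (v k) \<le> L" for k
  proof -
    obtain d where d: "d > 0" "ball (y k) d \<subseteq> X" using open_X y_X open_contains_ball by blast
    show ?thesis by (rule norm_clarke_gradient_le[OF lipschitz_on_subset[OF lip d(2)] d(1) v])
  qed
  have x_box: "x k \<in> cbox a b" for k
  proof (cases k)
    case (Suc j)
    then show ?thesis using x_Suc closest_point_in_set[of "cbox a b" "y j"] x0_box by auto
  qed (use x0_box in simp)
  have "compact (gradf ` cbox a b)"
    using continuous_on_subset[OF f_C1 box_X] by (intro compact_continuous_image) auto
  from compact_imp_bounded[OF this] obtain B where B: "\<And>z. z \<in> cbox a b \<Longrightarrow> norm (gradf z) \<le> B"
    unfolding bounded_iff by auto
  have "(\<lambda>k. \<gamma> (Suc k) *\<^sub>R e (Suc k)) \<longlonglongrightarrow> 0"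
    using e_sum_Suc by (intro summable_LIMSEQ_zero) (simp add: summable_iff_convergent)
  then have "(\<lambda>k. \<gamma> (Suc k) * (B + L) + \<gamma> (Suc k) * norm (r (Suc k)) + norm (\<gamma> (Suc k) *\<^sub>R e (Suc k)))
      \<longlonglongrightarrow> 0 * (B + L) + 0 * norm (0::'a) + norm (0::'a)"
    by (intro tendsto_intros LIMSEQ_Suc[OF \<gamma>_lim] LIMSEQ_Suc[OF r_lim])
  then have null: "(\<lambda>k. \<gamma> (Suc k) * (B + L) + \<gamma> (Suc k) * norm (r (Suc k)) + norm (\<gamma> (Suc k) *\<^sub>R e (Suc k)))
      \<longlonglongrightarrow> 0" by simp
  have "norm (y k - x (Suc k))
      \<le> \<gamma> (Suc k) * (B + L) + \<gamma> (Suc k) * norm (r (Suc k)) + norm (\<gamma> (Suc k) *\<^sub>R e (Suc k))" for k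
  proof -
    \<comment> \<open>The projection is at least as close to \<open>y k\<close> as the previous
      iterate, which lies in the box.\<close>
    have "norm (y k - x (Suc k)) \<le> norm (x k - y k)"
      using closest_point_le[OF closed_cbox x_box[of k], of "y k"] by (simp add: x_Suc dist_norm norm_minus_commute)
    also have "x k - y k = \<gamma> (Suc k) *\<^sub>R (gradf (x k) + v k) + \<gamma> (Suc k) *\<^sub>R r (Suc k) + \<gamma> (Suc k) *\<^sub>R e (Suc k)"
      using step[of k] unfolding h_Suc by (simp add: algebra_simps)
    also have "norm \<dots> \<le> norm (\<gamma> (Suc k) *\<^sub>R (gradf (x k) + v k)) + norm (\<gamma> (Suc k) *\<^sub>R r (Suc k))
        + norm (\<gamma> (Suc k) *\<^sub>R e (Suc k))"
      by (rule norm_triangle_le) (intro add_right_mono norm_triangle_ineq)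
    also have "norm (\<gamma> (Suc k) *\<^sub>R r (Suc k)) = \<gamma> (Suc k) * norm (r (Suc k))"
      using pos[of k] by simp
    also have "norm (\<gamma> (Suc k) *\<^sub>R (gradf (x k) + v k)) \<le> \<gamma> (Suc k) * (B + L)"
      using pos[of k] norm_triangle_le[OF add_mono[OF B[OF x_box[of k]] v_bound[of k]]]
      by (simp add: mult_left_mono)
    finally show ?thesis by simp
  qed
  then have near: "(\<lambda>k. y k - x (Suc k)) \<longlonglongrightarrow> 0"
    by (intro Lim_null_comparison[OF _ null] always_eventually allI)
  show ?thesis
  proof (rule decomposed_iteration_converges[OF x_box _ _ v v_bound near])
    show "y k - x (Suc k) \<in> normal_cone (cbox a b) (x (Suc k))" for k
      unfolding x_Suc by (rule closest_point_normal_cone[OF convex_box(1) closed_cbox])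
    show "x k - \<gamma> (Suc k) *\<^sub>R h (Suc k) = x (Suc k) + \<gamma> (Suc k) *\<^sub>R v k + (y k - x (Suc k))" for k
      unfolding step by simp
  qed
qed

end

section \<open>Almost sure convergence from the sample paths\<close>

theorem theorem4p2:
  fixes a b x0 :: "real ^ 'n"
    and X K S :: "(real ^ 'n) set"
    and f g :: "real ^ 'n \<Rightarrow> real"
    and gradf :: "real ^ 'n \<Rightarrow> real ^ 'n"
    and \<gamma> :: "nat \<Rightarrow> real"
    and M :: "'w measure"
    and x H e r :: "nat \<Rightarrow> 'w \<Rightarrow> real ^ 'n"
  defines "K \<equiv> cbox a b"
    and "S \<equiv> stationary_set K gradf g"
  assumes ab: "\<And>i. a $ i < b $ i"
    and X: "open X" "K \<subseteq> X"
    and f_grad: "\<And>y. y \<in> X \<Longrightarrow> GDERIV f y :> gradf y"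
    and f_C1: "continuous_on X gradf"
    and g_lip: "locally_lipschitz_on X g"
    and g_bdd: "bdd_below (g ` X)"
    and g_regular: "clarke_regular_on X g"
    and \<gamma>_pos: "\<And>k. k \<ge> 1 \<Longrightarrow> \<gamma> k > 0"
    and \<gamma>_sum: "filterlim (\<lambda>n. \<Sum>k=1..n. \<gamma> k) at_top sequentially"
    and \<gamma>_lim: "\<gamma> \<longlonglongrightarrow> 0"
    and M: "prob_space M"
    and x0: "x0 \<in> K" "\<And>\<omega>. \<omega> \<in> space M \<Longrightarrow> x 0 \<omega> = x0"
    and x_rv: "\<And>k. k \<ge> 1 \<Longrightarrow> x k \<in> borel_measurable M"
    and H_rv: "\<And>k. k \<ge> 1 \<Longrightarrow> H k \<in> borel_measurable M"
    and e_rv: "\<And>k. k \<ge> 1 \<Longrightarrow> e k \<in> borel_measurable M"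
    and r_rv: "\<And>k. k \<ge> 1 \<Longrightarrow> r k \<in> borel_measurable M"
    and \<delta>: "AE \<omega> in M. \<forall>k\<ge>1. H k \<omega> - gradf (x (k - 1) \<omega>) = e k \<omega> + r k \<omega>"
    and r_lim: "AE \<omega> in M. (\<lambda>k. norm (r k \<omega>)) \<longlonglongrightarrow> 0"
    and e_sum: "AE \<omega> in M. convergent (\<lambda>n. \<Sum>k=1..n. \<gamma> k *\<^sub>R e k \<omega>)"
    and S_values: "interior ((\<lambda>y. f y + g y) ` S) = {}"
  shows "((AE \<omega> in M. prox_iteration_A X K g \<gamma> (\<lambda>k. H k \<omega>) (\<lambda>k. x k \<omega>)) \<longrightarrow>
            (AE \<omega> in M. converges_to_set (\<lambda>k. x k \<omega>) S)) \<and>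
         ((\<exists>L. L-lipschitz_on X g) \<and>
          (AE \<omega> in M. prox_iteration_B X K g \<gamma> (\<lambda>k. H k \<omega>) (\<lambda>k. x k \<omega>)) \<longrightarrow>
            (AE \<omega> in M. converges_to_set (\<lambda>k. x k \<omega>) S))"
proof -
  have path: "AE \<omega> in M. noisy_proximal_iteration a b X f g gradf \<gamma>
      (\<lambda>k. x k \<omega>) (\<lambda>k. H k \<omega>) (\<lambda>k. e k \<omega>) (\<lambda>k. r k \<omega>)"
    \<comment> \<open>\<open>AE_space\<close> enters because the initial value is prescribed only
      for \<open>\<omega>\<close> in the sample space.\<close>
    using \<delta> r_lim e_sum AE_space
  proof eventually_elim
    case (elim \<omega>)
    show ?case
    proof
      show "x 0 \<omega> \<in> cbox a b" using x0 elim(4) by (simp add: K_def)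
      show "(\<lambda>k. r k \<omega>) \<longlonglongrightarrow> 0" using elim(2) by (rule tendsto_norm_zero_cancel)
      show "convergent (\<lambda>n. \<Sum>k=1..n. \<gamma> k *\<^sub>R e k \<omega>)" by (rule elim(3))
      show "H k \<omega> - gradf (x (k - 1) \<omega>) = e k \<omega> + r k \<omega>" if "k \<ge> 1" for k
        using elim(1) that by blast
      show "interior ((\<lambda>z. f z + g z) ` stationary_set (cbox a b) gradf g) = {}"
        using S_values by (simp add: S_def K_def)
    qed (use X f_grad f_C1 g_lip g_regular \<gamma>_pos \<gamma>_sum \<gamma>_lim in \<open>auto simp: K_def\<close>)
  qed
  have "AE \<omega> in M. converges_to_set (\<lambda>k. x k \<omega>) S"
    if "AE \<omega> in M. prox_iteration_A X K g \<gamma> (\<lambda>k. H k \<omega>) (\<lambda>k. x k \<omega>)"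
    using path that unfolding S_def K_def
    by eventually_elim (rule noisy_proximal_iteration.prox_iteration_A_converges)
  moreover have "AE \<omega> in M. converges_to_set (\<lambda>k. x k \<omega>) S"
    if "L-lipschitz_on X g" "AE \<omega> in M. prox_iteration_B X K g \<gamma> (\<lambda>k. H k \<omega>) (\<lambda>k. x k \<omega>)" for L
    using path that(2) unfolding S_def K_def
    by eventually_elim (rule noisy_proximal_iteration.prox_iteration_B_converges[OF _ that(1)])
  ultimately show ?thesis by blast
qed

end
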